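(* Let $X$ be an Asplund space and $G\subset X$ be open. Let $f\colon G\to\mathbb{R}$ be a continuous and approximately convex function. Then the set $N_F(f)$ of all points of $G$ at which $f$ is not Fréchet differentiable is cone small.
   Context: Normed spaces are real; $U(x,r)$ denotes the open ball. A Banach space is Asplund if each of its separable subspaces has separable dual. A function $f\colon G\to\mathbb{R}$ on an open subset $G$ of a Banach space $X$ is approximately convex at $x_0\in G$ if for every $\varepsilon>0$ there exists $\delta>0$ (small enough that $U(x_0,\delta)\subset G$) such that $$f(\lambda x+(1-\lambda)y)\le\lambda f(x)+(1-\lambda)f(y)+\varepsilon\lambda(1-\lambda)\|x-y\|$$ whenever $\lambda\in[0,1]$ and $x,y\in U(x_0,\delta)$. $f$ is approximately convex (on $G$) if it is approximately convex at each $x_0\in G$. For $x^*\in X^*\setminus\{0\}$ and $\alpha\in[0,1)$ put $C(x^*,\alpha)=\{x\in X: \alpha\|x\|\,\|x^*\|<x^*(x)\}$. A set $A\subset X$ is $\alpha$-cone porous at $x\in X$ if there exists $R>0$ such that for each $\varepsilon>0$ there exist $z\in U(x,\varepsilon)$ and $x^*\in X^*\setminus\{0\}$ with $U(x,R)\cap(z+C(x^*,\alpha))\cap A=\emptyset$. $A$ is $\alpha$-cone porous if it is $\alpha$-cone porous at each of its points, and $\sigma$-$\alpha$-cone porous if it is a countable union of $\alpha$-cone porous sets. $A$ is cone small if it is $\sigma$-$\alpha$-cone porous for each $\alpha\in(0,1)$. *)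

theory Defs
  imports "HOL-Analysis.Analysis"
begin

text \<open>
  The dual of a linear subspace \<open>Y\<close>. A functional on \<open>Y\<close> is represented by a function on the whole
  space that is \<open>undefined\<close> outside \<open>Y\<close>, so that equal functionals are equal as functions.
\<close>

definition subspace_dual :: "'a::real_normed_vector set \<Rightarrow> ('a \<Rightarrow> real) set" where
  "subspace_dual Y =
    {\<phi> \<in> extensional Y.
      (\<forall>x\<in>Y. \<forall>y\<in>Y. \<phi> (x + y) = \<phi> x + \<phi> y) \<and>
      (\<forall>c. \<forall>x\<in>Y. \<phi> (c *\<^sub>R x) = c * \<phi> x) \<and>
      (\<exists>K. \<forall>x\<in>Y. \<bar>\<phi> x\<bar> \<le> K * norm x)}"

text \<open>
  The distance of the dual norm. The value outside the dual is irrelevant; it is set to \<open>0\<close> because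
  the locale \<open>Metric_space\<close> requires a distance that is nonnegative everywhere.
\<close>

definition subspace_dual_dist :: "'a::real_normed_vector set \<Rightarrow> ('a \<Rightarrow> real) \<Rightarrow> ('a \<Rightarrow> real) \<Rightarrow> real" where
  "subspace_dual_dist Y \<phi> \<psi> =
    (if \<phi> \<in> subspace_dual Y \<and> \<psi> \<in> subspace_dual Y
     then (SUP y\<in>{y \<in> Y. norm y \<le> 1}. \<bar>\<phi> y - \<psi> y\<bar>) else 0)"

lemma bdd_above_subspace_dual_diff:
  assumes "\<phi> \<in> subspace_dual Y" "\<psi> \<in> subspace_dual Y"
  shows "bdd_above ((\<lambda>y. \<bar>\<phi> y - \<psi> y\<bar>) ` {y \<in> Y. norm y \<le> 1})"
proof -
  obtain K L where K: "\<And>x. x \<in> Y \<Longrightarrow> \<bar>\<phi> x\<bar> \<le> K * norm x" and L: "\<And>x. x \<in> Y \<Longrightarrow> \<bar>\<psi> x\<bar> \<le> L * norm x"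
    using assms unfolding subspace_dual_def by blast
  have "\<bar>\<phi> y - \<psi> y\<bar> \<le> \<bar>K\<bar> + \<bar>L\<bar>" if "y \<in> Y" "norm y \<le> 1" for y
  proof -
    have "\<bar>\<phi> y\<bar> \<le> \<bar>K\<bar> * 1"
      by (rule order_trans[OF K[OF that(1)]], rule mult_mono) (use that in auto)
    moreover have "\<bar>\<psi> y\<bar> \<le> \<bar>L\<bar> * 1"
      by (rule order_trans[OF L[OF that(1)]], rule mult_mono) (use that in auto)
    ultimately show ?thesis by linarith
  qed
  then show ?thesis by (intro bdd_aboveI2) blast
qed

lemma subspace_dual_dist_upper:
  assumes "\<phi> \<in> subspace_dual Y" "\<psi> \<in> subspace_dual Y" "y \<in> Y" "norm y \<le> 1"
  shows "\<bar>\<phi> y - \<psi> y\<bar> \<le> subspace_dual_dist Y \<phi> \<psi>"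
  using assms by (auto simp: subspace_dual_dist_def intro!: cSUP_upper bdd_above_subspace_dual_diff)

lemma Metric_space_subspace_dual:
  fixes Y :: "'a::real_normed_vector set"
  assumes "subspace Y"
  shows "Metric_space (subspace_dual Y) (subspace_dual_dist Y)"
proof
  have 0: "0 \<in> {y \<in> Y. norm y \<le> 1}" using assms by (simp add: subspace_0)
  fix \<phi> \<psi> :: "'a \<Rightarrow> real"
  show "0 \<le> subspace_dual_dist Y \<phi> \<psi>"
  proof (cases "\<phi> \<in> subspace_dual Y \<and> \<psi> \<in> subspace_dual Y")
    case True
    then have "\<bar>\<phi> 0 - \<psi> 0\<bar> \<le> subspace_dual_dist Y \<phi> \<psi>"
      using 0 by (intro subspace_dual_dist_upper) auto
    then show ?thesis by linarith
  qed (auto simp: subspace_dual_dist_def)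
  show "subspace_dual_dist Y \<phi> \<psi> = subspace_dual_dist Y \<psi> \<phi>"
    by (simp add: subspace_dual_dist_def abs_minus_commute conj_commute)
  assume D: "\<phi> \<in> subspace_dual Y" "\<psi> \<in> subspace_dual Y"
  show "subspace_dual_dist Y \<phi> \<psi> = 0 \<longleftrightarrow> \<phi> = \<psi>"
  proof
    assume z: "subspace_dual_dist Y \<phi> \<psi> = 0"
    have "\<phi> y = \<psi> y" if y: "y \<in> Y" for y
    proof (cases "y = 0")
      case True
      have "\<phi> (0 *\<^sub>R y) = 0 * \<phi> y" "\<psi> (0 *\<^sub>R y) = 0 * \<psi> y"
        using D y unfolding subspace_dual_def by blast+
      then show ?thesis using True by simp
    next
      case False
      define u where "u = inverse (norm y) *\<^sub>R y"
      have "u \<in> Y" "norm u \<le> 1"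
        using y assms False by (auto simp: u_def subspace_scale)
      then have "\<phi> u = \<psi> u"
        using subspace_dual_dist_upper[OF D, of u] z by simp
      moreover have "\<phi> u = inverse (norm y) * \<phi> y" "\<psi> u = inverse (norm y) * \<psi> y"
        using D y unfolding subspace_dual_def u_def by blast+
      ultimately show ?thesis using False by simp
    qed
    then show "\<phi> = \<psi>"
      using D by (intro extensionalityI[of _ Y]) (auto simp: subspace_dual_def)
  next
    assume "\<phi> = \<psi>"
    then show "subspace_dual_dist Y \<phi> \<psi> = 0"
      using 0 by (auto simp: subspace_dual_dist_def image_constant_conv)
  qed
  fix \<eta> :: "'a \<Rightarrow> real"
  assume E: "\<eta> \<in> subspace_dual Y"
  have "(SUP y\<in>{y \<in> Y. norm y \<le> 1}. \<bar>\<phi> y - \<eta> y\<bar>) \<le> subspace_dual_dist Y \<phi> \<psi> + subspace_dual_dist Y \<psi> \<eta>"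
  proof (rule cSUP_least)
    fix y assume "y \<in> {y \<in> Y. norm y \<le> 1}"
    then show "\<bar>\<phi> y - \<eta> y\<bar> \<le> subspace_dual_dist Y \<phi> \<psi> + subspace_dual_dist Y \<psi> \<eta>"
      using subspace_dual_dist_upper[OF D, of y] subspace_dual_dist_upper[OF D(2) E, of y] by auto
  qed (use 0 in blast)
  then show "subspace_dual_dist Y \<phi> \<eta> \<le> subspace_dual_dist Y \<phi> \<psi> + subspace_dual_dist Y \<psi> \<eta>"
    using D E by (simp add: subspace_dual_dist_def)
qed

definition asplund_space :: "'a::banach itself \<Rightarrow> bool" where
  "asplund_space T \<longleftrightarrow>
    (\<forall>Y :: 'a set. subspace Y \<and> separable_space (top_of_set Y) \<longrightarrow>
      separable_space (Metric_space.mtopology (subspace_dual Y) (subspace_dual_dist Y)))"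

definition approximately_convex_at :: "'a::real_normed_vector set \<Rightarrow> ('a \<Rightarrow> real) \<Rightarrow> 'a \<Rightarrow> bool" where
  "approximately_convex_at G f x0 \<longleftrightarrow>
    (\<forall>\<epsilon>>0. \<exists>\<delta>>0. ball x0 \<delta> \<subseteq> G \<and>
      (\<forall>l\<in>{0..1}. \<forall>x\<in>ball x0 \<delta>. \<forall>y\<in>ball x0 \<delta>.
        f (l *\<^sub>R x + (1 - l) *\<^sub>R y)
          \<le> l * f x + (1 - l) * f y + \<epsilon> * l * (1 - l) * norm (x - y)))"

definition approximately_convex_on :: "'a::real_normed_vector set \<Rightarrow> ('a \<Rightarrow> real) \<Rightarrow> bool" where
  "approximately_convex_on G f \<longleftrightarrow> (\<forall>x0\<in>G. approximately_convex_at G f x0)"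

definition dual_cone :: "('a::real_normed_vector \<Rightarrow>\<^sub>L real) \<Rightarrow> real \<Rightarrow> 'a set" where
  "dual_cone x' \<alpha> = {x. \<alpha> * norm x * norm x' < blinfun_apply x' x}"

definition cone_porous_at :: "real \<Rightarrow> 'a::real_normed_vector set \<Rightarrow> 'a \<Rightarrow> bool" where
  "cone_porous_at \<alpha> A x \<longleftrightarrow>
    (\<exists>R>0. \<forall>\<epsilon>>0. \<exists>z\<in>ball x \<epsilon>. \<exists>x' :: 'a \<Rightarrow>\<^sub>L real. x' \<noteq> 0 \<and>
      ball x R \<inter> (+) z ` dual_cone x' \<alpha> \<inter> A = {})"

definition cone_porous :: "real \<Rightarrow> 'a::real_normed_vector set \<Rightarrow> bool" where
  "cone_porous \<alpha> A \<longleftrightarrow> (\<forall>x\<in>A. cone_porous_at \<alpha> A x)"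

definition sigma_cone_porous :: "real \<Rightarrow> 'a::real_normed_vector set \<Rightarrow> bool" where
  "sigma_cone_porous \<alpha> A \<longleftrightarrow> (\<exists>B :: nat \<Rightarrow> 'a set. (\<forall>n. cone_porous \<alpha> (B n)) \<and> A = (\<Union>n. B n))"

definition cone_small :: "'a::real_normed_vector set \<Rightarrow> bool" where
  "cone_small A \<longleftrightarrow> (\<forall>\<alpha>. 0 < \<alpha> \<and> \<alpha> < 1 \<longrightarrow> sigma_cone_porous \<alpha> A)"

end

theory Submission
  imports Defs
begin

text \<open>
  Let \<open>f\<close> fail to be differentiable at \<open>x\<close>. An approximately convex function has subgradients at every
  point, so the failure is a kink: for some \<open>c > 0\<close> there are arbitrarily small \<open>h\<close> with
  \<open>f (x + h) + f (x - h) - 2 f x > c norm h\<close> (lemma \<open>differentiable_if_symmetric\<close>). The set of points where this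
  holds for a fixed \<open>c\<close> need not be cone porous, but its intersection with a set whose points
  have subgradients nearly equal to one functional \<open>\<phi>\<close> is. At the end point \<open>z\<close> of the kink, a subgradient \<open>\<zeta>\<close>
  differs from \<open>\<phi>\<close> by a definite amount, and since subgradients are approximately monotone, the points
  of the set stay out of the cone with vertex \<open>z\<close> in the direction \<open>\<zeta> - \<phi>\<close>
  (lemma \<open>cone_porous_if_nearly_constant_subgradient\<close>).

  It remains to decompose \<open>G\<close> into countably many sets with nearly constant subgradients. If the
  dual is separable, one covers it by countably many small balls. In general this is impossible, but
  it suffices that each set has nearly constant subgradients locally, in a ball around each of its
  points, with a functional depending on the point, because cone porosity only concerns such balls.
  Such sets come from three ingredients. First, bounded sets of functionals on an Asplund space
  are fragmented: each has a nonempty relatively weak-star open subset of small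
  diameter (\<open>asplund_dual_ball_fragmented\<close>). Second, minimal closed subrelations of the
  subgradient graph transport this to the domain: every nonempty relatively closed subset of \<open>G\<close> has
  a nonempty relatively open piece on which a selection of subgradients has small range
  (\<open>fragmented_selection\<close>, \<open>nearly_constant_subgradient_piece\<close>). Third, removing such pieces
  transfinitely exhausts \<open>G\<close>, and the pieces can be collected into countably many sets in each of
  which different pieces have positive distance (\<open>sigma_locally_contained\<close>).
\<close>

section \<open>Sublinear functionals dominate linear ones\<close>

definition sublinear :: "('a::real_vector \<Rightarrow> real) \<Rightarrow> bool" where
  "sublinear p \<longleftrightarrow>
    (\<forall>x y. p (x + y) \<le> p x + p y) \<and> (\<forall>c>0. \<forall>x. p (c *\<^sub>R x) = c * p x)"

lemma sublinearI:
  assumes "\<And>x y. p (x + y) \<le> p x + p y"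
    and le: "\<And>c x. c > 0 \<Longrightarrow> p (c *\<^sub>R x) \<le> c * p x"
  shows "sublinear p"
proof -
  have "p (c *\<^sub>R x) = c * p x" if c: "c > 0" for c x
  proof -
    have "c * p (inverse c *\<^sub>R (c *\<^sub>R x)) \<le> c * (inverse c * p (c *\<^sub>R x))"
      using c le[of "inverse c" "c *\<^sub>R x"] by (intro mult_left_mono) auto
    then have "c * p x \<le> p (c *\<^sub>R x)" using c by (simp add: field_simps)
    then show ?thesis using le[OF c, of x] by linarith
  qed
  then show ?thesis using assms unfolding sublinear_def by blast
qed

lemma sublinear_zero: "sublinear p \<Longrightarrow> p 0 = 0"
proof -
  assume "sublinear p"
  then have "p (2 *\<^sub>R 0) = 2 * p 0" unfolding sublinear_def by (metis zero_less_numeral)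
  then show ?thesis by simp
qed

lemma sublinear_lower:
  assumes "sublinear p"
  shows "- p (- x) \<le> p x"
proof -
  have "p (x + - x) \<le> p x + p (- x)" using assms unfolding sublinear_def by blast
  then show ?thesis using sublinear_zero[OF assms] by simp
qed

text \<open>
  Zorn's lemma applies because \<open>- p (- x)\<close> bounds every sublinear functional below \<open>p\<close> from below at
  \<open>x\<close>; the pointwise infimum of a chain is therefore finite, and it is subadditive because two
  members of the chain can be compared.
\<close>

lemma minimal_sublinear_below:
  fixes p :: "'a::real_vector \<Rightarrow> real"
  assumes p: "sublinear p"
  obtains q where "sublinear q" "q \<le> p" "\<And>r. sublinear r \<Longrightarrow> r \<le> q \<Longrightarrow> r = q"
proof -
  define A where "A = {q. sublinear q \<and> q \<le> p}"
  have "\<exists>m\<in>A. \<forall>a\<in>A. a \<le> m \<longrightarrow> a = m"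
  proof (rule predicate_Zorn)
    show "partial_order_on A (relation_of (\<lambda>x y. y \<le> x) A)"
      by (rule partial_order_on_relation_ofI) auto
    fix C assume C: "C \<in> Chains (relation_of (\<lambda>x y. y \<le> x) A)"
    show "\<exists>u\<in>A. \<forall>a\<in>C. u \<le> a"
    proof (cases "C = {}")
      case True
      then show ?thesis using p by (auto simp: A_def)
    next
      case False
      have CA: "C \<subseteq> A" and lin: "\<And>q r. q \<in> C \<Longrightarrow> r \<in> C \<Longrightarrow> q \<le> r \<or> r \<le> q"
        using C unfolding Chains_def relation_of_def by auto
      define u where "u h = (INF q\<in>C. q h)" for h
      have bdd: "bdd_below ((\<lambda>q. q h) ` C)" for h
      proof (rule bdd_belowI2)
        fix q assume "q \<in> C"
        then have q: "sublinear q" "q \<le> p" using CA by (auto simp: A_def)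
        show "- p (- h) \<le> q h"
          using sublinear_lower[OF q(1), of h] le_funD[OF q(2), of "- h"] by linarith
      qed
      have ule: "u h \<le> q h" if "q \<in> C" for q h
        unfolding u_def using bdd that by (intro cINF_lower)
      have uge: "b \<le> u h" if "\<And>q. q \<in> C \<Longrightarrow> b \<le> q h" for b h
        unfolding u_def using False that by (intro cINF_greatest)
      have "sublinear u"
      proof (rule sublinearI)
        fix x y
        have "u (x + y) \<le> q x + r y" if qr: "q \<in> C" "r \<in> C" for q r
        proof -
          obtain m where m: "m \<in> C" "m \<le> q" "m \<le> r" using lin[OF qr] qr by blast
          have "u (x + y) \<le> m (x + y)" using ule m by blast
          also have "\<dots> \<le> m x + m y" using m CA unfolding A_def sublinear_def by blast
          also have "\<dots> \<le> q x + r y" using m by (intro add_mono) (auto simp: le_fun_def)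
          finally show ?thesis .
        qed
        then have "u (x + y) - r y \<le> q x" if "q \<in> C" "r \<in> C" for q r
          using that by (simp add: algebra_simps)
        then have "u (x + y) - r y \<le> u x" if "r \<in> C" for r using uge that by blast
        then have "u (x + y) - u x \<le> r y" if "r \<in> C" for r using that by (simp add: algebra_simps)
        then have "u (x + y) - u x \<le> u y" using uge by blast
        then show "u (x + y) \<le> u x + u y" by simp
      next
        fix c :: real and x
        assume c: "c > 0"
        have "u (c *\<^sub>R x) / c \<le> q x" if q: "q \<in> C" for q
        proof -
          have "q (c *\<^sub>R x) = c * q x" using q CA c unfolding A_def sublinear_def by blast
          then show ?thesis using ule[OF q, of "c *\<^sub>R x"] c by (simp add: field_simps)
        qed
        then have "u (c *\<^sub>R x) / c \<le> u x" using uge by blast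
        then show "u (c *\<^sub>R x) \<le> c * u x" using c by (simp add: field_simps)
      qed
      moreover have "u \<le> p"
      proof (rule le_funI)
        fix h
        obtain q where q: "q \<in> C" using False by blast
        then have "q h \<le> p h" using CA unfolding A_def le_fun_def by blast
        then show "u h \<le> p h" using ule[OF q, of h] by linarith
      qed
      ultimately show ?thesis using ule by (auto simp: A_def le_fun_def)
    qed
  qed
  then show ?thesis using that unfolding A_def by (smt (verit) mem_Collect_eq order_trans)
qed

text \<open>
  A minimal sublinear functional \<open>q\<close> is linear: for each \<open>x\<close>, the functional
  \<open>y \<mapsto> inf (q (y + t x) - t q x)\<close>, the infimum over \<open>t \<ge> 0\<close>, is sublinear and at most \<open>q\<close>, hence equal
  to \<open>q\<close>, and its value at \<open>- x\<close> is at most \<open>- q x\<close>. This is the part of the Hahn--Banach theorem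
  that produces subgradients.
\<close>

lemma Hahn_Banach_sublinear:
  fixes p :: "'a::real_vector \<Rightarrow> real"
  assumes "sublinear p"
  obtains \<phi> where "linear \<phi>" "\<And>x. \<phi> x \<le> p x"
proof -
  obtain q where q: "sublinear q" "q \<le> p" and min: "\<And>r. sublinear r \<Longrightarrow> r \<le> q \<Longrightarrow> r = q"
    using minimal_sublinear_below[OF assms] by blast
  have add: "q (x + y) \<le> q x + q y" for x y using q unfolding sublinear_def by blast
  have scale: "c > 0 \<Longrightarrow> q (c *\<^sub>R x) = c * q x" for c x using q unfolding sublinear_def by blast
  have zero: "q 0 = 0" using sublinear_zero q by blast
  have scale0: "c \<ge> 0 \<Longrightarrow> q (c *\<^sub>R x) = c * q x" for c x
    using scale zero by (cases "c = 0") auto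
  have odd: "q (- x) = - q x" for x
  proof -
    define r where "r y = (INF t\<in>{0..}. q (y + t *\<^sub>R x) - t * q x)" for y
    have bdd: "bdd_below ((\<lambda>t. q (y + t *\<^sub>R x) - t * q x) ` {0..})" for y
    proof (rule bdd_belowI2)
      fix t :: real assume t: "t \<in> {0..}"
      have "q (t *\<^sub>R x) \<le> q (y + t *\<^sub>R x) + q (- y)" using add[of "y + t *\<^sub>R x" "- y"] by simp
      then show "- q (- y) \<le> q (y + t *\<^sub>R x) - t * q x" using scale0 t by simp
    qed
    have rle: "r y \<le> q (y + t *\<^sub>R x) - t * q x" if "t \<ge> 0" for y t
      unfolding r_def using bdd that by (intro cINF_lower) auto
    have rge: "b \<le> r y" if "\<And>t. t \<ge> 0 \<Longrightarrow> b \<le> q (y + t *\<^sub>R x) - t * q x" for b y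
      unfolding r_def using that by (intro cINF_greatest) auto
    have "sublinear r"
    proof (rule sublinearI)
      fix y z
      have "r (y + z) \<le> (q (y + s *\<^sub>R x) - s * q x) + (q (z + t *\<^sub>R x) - t * q x)"
        if "s \<ge> 0" "t \<ge> 0" for s t
      proof -
        have "r (y + z) \<le> q ((y + z) + (s + t) *\<^sub>R x) - (s + t) * q x"
          using rle that by simp
        also have "(y + z) + (s + t) *\<^sub>R x = (y + s *\<^sub>R x) + (z + t *\<^sub>R x)"
          by (simp add: algebra_simps)
        finally show ?thesis using add[of "y + s *\<^sub>R x" "z + t *\<^sub>R x"] by (simp add: algebra_simps)
      qed
      then have "r (y + z) - (q (z + t *\<^sub>R x) - t * q x) \<le> q (y + s *\<^sub>R x) - s * q x"
        if "s \<ge> 0" "t \<ge> 0" for s t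
        using that by (smt (verit))
      then have "r (y + z) - (q (z + t *\<^sub>R x) - t * q x) \<le> r y" if "t \<ge> 0" for t
        using rge that by blast
      then have "r (y + z) - r y \<le> q (z + t *\<^sub>R x) - t * q x" if "t \<ge> 0" for t
        using that by (smt (verit))
      then have "r (y + z) - r y \<le> r z" using rge by blast
      then show "r (y + z) \<le> r y + r z" by simp
    next
      fix c :: real and y
      assume c: "c > 0"
      have "r (c *\<^sub>R y) / c \<le> q (y + t *\<^sub>R x) - t * q x" if "t \<ge> 0" for t
      proof -
        have "r (c *\<^sub>R y) \<le> q (c *\<^sub>R y + (c * t) *\<^sub>R x) - (c * t) * q x"
          using rle that c by simp
        also have "c *\<^sub>R y + (c * t) *\<^sub>R x = c *\<^sub>R (y + t *\<^sub>R x)"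
          by (simp add: algebra_simps)
        also have "q (c *\<^sub>R (y + t *\<^sub>R x)) = c * q (y + t *\<^sub>R x)" by (rule scale[OF c])
        finally have "r (c *\<^sub>R y) \<le> c * (q (y + t *\<^sub>R x) - t * q x)"
          by (simp add: algebra_simps)
        then show ?thesis using c by (simp add: field_simps)
      qed
      then have "r (c *\<^sub>R y) / c \<le> r y" using rge by blast
      then show "r (c *\<^sub>R y) \<le> c * r y" using c by (simp add: field_simps)
    qed
    moreover have "r \<le> q" using rle[of 0] by (simp add: le_fun_def)
    ultimately have "r = q" using min by blast
    then have "q (- x) \<le> - q x" using rle[of 1 "- x"] zero by simp
    then show ?thesis using sublinear_lower[OF q(1), of "x"] by linarith
  qed
  have "linear q"
  proof (rule linearI)
    fix x y
    show "q (x + y) = q x + q y"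
      using add[of x y] add[of "x + y" "- y"] odd[of y] by simp
  next
    fix c :: real and x
    show "q (c *\<^sub>R x) = c *\<^sub>R q x"
    proof (cases "c \<ge> 0")
      case True then show ?thesis using scale0 by simp
    next
      case False
      then have "q ((- c) *\<^sub>R x) = (- c) * q x" by (intro scale0) simp
      then show ?thesis using odd[of "c *\<^sub>R x"] by simp
    qed
  qed
  then show ?thesis using that q(2) by (auto simp: le_fun_def)
qed

section \<open>Exhausting a set by pieces\<close>

text \<open>
  The sets obtained from \<open>{}\<close> by transfinite iteration of \<open>s\<close>, with unions at limit stages.
\<close>

inductive_set tower :: "('a set \<Rightarrow> 'a set) \<Rightarrow> 'a set set" for s where
  suc: "W \<in> tower s \<Longrightarrow> s W \<in> tower s"
| Union: "\<A> \<in> Pow (tower s) \<Longrightarrow> \<Union>\<A> \<in> tower s"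
monos Pow_mono

text \<open>
  For increasing \<open>s\<close> the tower behaves like a well-ordered sequence. First, if \<open>A\<close> has the stated
  property with respect to all smaller members, then every member is either contained in \<open>A\<close> or
  contains \<open>s A\<close>; this comparison then carries the property up the tower.
\<close>

lemma tower_strictly_below:
  assumes incr: "\<And>W. W \<subseteq> s W" and A: "A \<in> tower s" and B: "B \<in> tower s"
    and "B \<subset> A"
  shows "s B \<subseteq> A"
proof -
  have cmp: "B \<subseteq> A \<or> s A \<subseteq> B"
    if "\<forall>B\<in>tower s. B \<subset> A \<longrightarrow> s B \<subseteq> A" "B \<in> tower s" for A B
    using that(2)
  proof induction
    case (suc W)
    then consider "W \<subset> A" | "W = A" | "s A \<subseteq> W" by blast
    then show ?case
    proof cases
      case 1 then show ?thesis using that(1) suc.hyps by blast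
    next
      case 2 then show ?thesis by blast
    next
      case 3 then show ?thesis using incr[of W] by blast
    qed
  next
    case (Union \<A>)
    then show ?case by blast
  qed
  have "\<forall>B\<in>tower s. B \<subset> A \<longrightarrow> s B \<subseteq> A"
    using A
  proof induction
    case (suc A)
    show ?case
    proof (intro ballI impI)
      fix B assume B: "B \<in> tower s" "B \<subset> s A"
      then have "B \<subseteq> A" using cmp[OF suc.IH B(1)] by blast
      then show "s B \<subseteq> s A" using suc.IH B incr[of A] by (cases "B = A") auto
    qed
  next
    case (Union \<A>)
    show ?case
    proof (intro ballI impI)
      fix B assume B: "B \<in> tower s" "B \<subset> \<Union>\<A>"
      then obtain A where A: "A \<in> \<A>" "\<not> A \<subseteq> B" by blast
      then have ext: "\<forall>B\<in>tower s. B \<subset> A \<longrightarrow> s B \<subseteq> A" using Union by auto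
      have "B \<subseteq> A" using cmp[OF ext B(1)] incr[of A] A(2) by blast
      then have "B \<subset> A" using A(2) by blast
      then show "s B \<subseteq> \<Union>\<A>" using ext B(1) A(1) by blast
    qed
  qed
  then show ?thesis using B \<open>B \<subset> A\<close> by blast
qed

lemma tower_linear:
  assumes incr: "\<And>W. W \<subseteq> s W" and A: "A \<in> tower s" and B: "B \<in> tower s"
  shows "A \<subseteq> B \<or> B \<subseteq> A"
  using B
proof induction
  case (suc W)
  then show ?case
    using tower_strictly_below[OF incr A, of W] incr[of W] by blast
next
  case (Union \<A>)
  then show ?case by blast
qed

text \<open>
  Suppose that every nonempty remainder \<open>G - W\<close>, \<open>W\<close> open, contains a nonempty relatively open
  piece with property \<open>Q\<close>. Removing such pieces transfinitely partitions \<open>G\<close>, and the part of \<open>G\<close>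
  removed up to any stage is relatively open. Let \<open>W x\<close> be what has been removed before the stage
  at which \<open>x\<close> disappears, so that \<open>s (W x)\<close> is an open set containing \<open>x\<close>. The set \<open>B n\<close> consists of
  the points whose ball of radius \<open>1 / (n + 1)\<close> lies in \<open>s (W x)\<close>. If two points of \<open>B n\<close> are closer than
  this radius, then neither disappears after the other, so they lie in the same piece.
  Thus \<open>G\<close> is a countable union of sets that are locally, on balls of a fixed radius, contained in
  one piece, although there may be uncountably many pieces. This is the mechanism behind
  paracompactness of metric spaces, and it replaces separability.
\<close>

lemma sigma_locally_contained:
  fixes G :: "'a::metric_space set"
  assumes piece: "\<And>W. open W \<Longrightarrow> \<not> G \<subseteq> W \<Longrightarrow> \<exists>V. open V \<and> V \<inter> (G - W) \<noteq> {} \<and> Q (V \<inter> (G - W))"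
  obtains B :: "nat \<Rightarrow> 'a set"
  where "G = (\<Union>n. B n)" "\<And>n x. x \<in> B n \<Longrightarrow> \<exists>r>0. \<exists>U. Q U \<and> B n \<inter> ball x r \<subseteq> U"
proof -
  obtain V where V: "\<And>W. open W \<Longrightarrow> \<not> G \<subseteq> W \<Longrightarrow>
      open (V W) \<and> V W \<inter> (G - W) \<noteq> {} \<and> Q (V W \<inter> (G - W))"
  proof -
    have "\<forall>W. \<exists>V. open W \<and> \<not> G \<subseteq> W \<longrightarrow> open V \<and> V \<inter> (G - W) \<noteq> {} \<and> Q (V \<inter> (G - W))"
      using piece by blast
    from choice[OF this] show ?thesis using that by blast
  qed
  define s where "s W = (if open W \<and> \<not> G \<subseteq> W then W \<union> V W else W)" for W
  have incr: "W \<subseteq> s W" for W by (simp add: s_def)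
  have op: "open W" if "W \<in> tower s" for W
    using that by induction (use V in \<open>auto simp: s_def\<close>)
  \<comment> \<open>the largest member of the tower that omits \<open>x\<close>\<close>
  define W where "W x = \<Union>{W \<in> tower s. x \<notin> W}" for x
  have Wt: "W x \<in> tower s" for x unfolding W_def by (rule tower.Union) auto
  have xW: "x \<notin> W x" for x by (auto simp: W_def)
  have sW: "s (W x) = W x \<union> V (W x)" if "x \<in> G" for x
    using op[OF Wt] xW that by (auto simp: s_def)
  have xs: "x \<in> s (W x)" if "x \<in> G" for x
  proof (rule ccontr)
    assume "x \<notin> s (W x)"
    then have "s (W x) \<subseteq> W x" using tower.suc[OF Wt, of x] unfolding W_def by blast
    then show False using V[OF op[OF Wt], of x] sW[OF that] xW[of x] that by blast
  qed
  have eq: "W x = W y" if "x \<in> s (W y)" "y \<in> s (W x)" for x y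
  proof (rule ccontr)
    assume "W x \<noteq> W y"
    then have "W x \<subset> W y \<or> W y \<subset> W x" using tower_linear[OF incr Wt Wt] by blast
    then have "s (W x) \<subseteq> W y \<or> s (W y) \<subseteq> W x"
      using tower_strictly_below[OF incr Wt Wt] by blast
    then show False using that xW by blast
  qed
  define B where "B n = {x \<in> G. ball x (1 / Suc n) \<subseteq> s (W x)}" for n
  have "x \<in> (\<Union>n. B n)" if x: "x \<in> G" for x
  proof -
    have "open (s (W x))" using op tower.suc Wt by blast
    then obtain e where e: "e > 0" "ball x e \<subseteq> s (W x)"
      using xs[OF x] open_contains_ball by blast
    obtain n where "inverse (real (Suc n)) < e" using reals_Archimedean[OF e(1)] by blast
    then have "ball x (1 / Suc n) \<subseteq> ball x e" by (intro subset_ball) (simp add: inverse_eq_divide)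
    then show ?thesis using e x by (auto simp: B_def)
  qed
  then have "G = (\<Union>n. B n)" by (auto simp: B_def)
  moreover have "\<exists>r>0. \<exists>U. Q U \<and> B n \<inter> ball x r \<subseteq> U" if x: "x \<in> B n" for n x
  proof (intro exI conjI)
    have xG: "x \<in> G" using x by (simp add: B_def)
    show "0 < 1 / real (Suc n)" by simp
    show "Q (V (W x) \<inter> (G - W x))" using V[OF op[OF Wt], of x] xW[of x] xG by blast
    show "B n \<inter> ball x (1 / real (Suc n)) \<subseteq> V (W x) \<inter> (G - W x)"
    proof
      fix y assume y: "y \<in> B n \<inter> ball x (1 / real (Suc n))"
      then have "y \<in> s (W x)" "x \<in> s (W y)" and yG: "y \<in> G"
        using x by (auto simp: B_def dist_commute)
      then have "W x = W y" using eq by blast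
      then show "y \<in> V (W x) \<inter> (G - W x)" using xs[OF yG] sW[OF yG] xW[of y] yG by auto
    qed
  qed
  ultimately show ?thesis using that by blast
qed

section \<open>Small selections of compact-valued relations\<close>

lemma closed_projection_compact:
  fixes \<Gamma> :: "('a::topological_space \<times> 'b::topological_space) set"
  assumes K: "compact K" and cl: "closed \<Gamma>" and sub: "\<Gamma> \<subseteq> UNIV \<times> K"
  shows "closed (fst ` \<Gamma>)"
proof -
  have "open (- fst ` \<Gamma>)"
  proof (rule Topological_Spaces.openI)
    fix x assume x: "x \<in> - fst ` \<Gamma>"
    have "{x} \<times> K \<subseteq> - \<Gamma>" using x by force
    then obtain T where T: "x \<in> T" "open T" "T \<times> K \<subseteq> - \<Gamma>"
      using Elementary_Topology.tube_lemma[OF K open_Compl[OF cl]] by blast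
    have "y \<notin> fst ` \<Gamma>" if "y \<in> T" for y
    proof
      assume "y \<in> fst ` \<Gamma>"
      then obtain k where "(y, k) \<in> \<Gamma>" by auto
      then show False using sub T(3) that by blast
    qed
    then show "\<exists>T. open T \<and> x \<in> T \<and> T \<subseteq> - fst ` \<Gamma>" using T by (intro exI[of _ T]) auto
  qed
  then show ?thesis by (simp add: closed_def)
qed

text \<open>
  The intersection of a chain of closed relations with a common domain has the same domain, since
  the fibres lie in the compact set \<open>K\<close>. In the language of set-valued maps this is the existence
  of a minimal upper semicontinuous compact-valued map inside a given one.
\<close>

lemma minimal_closed_relation:
  fixes \<Gamma> :: "('a::topological_space \<times> 'b::topological_space) set"
  assumes K: "compact K" and cl: "closed \<Gamma>" and sub: "\<Gamma> \<subseteq> UNIV \<times> K"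
  obtains M where "closed M" "M \<subseteq> \<Gamma>" "fst ` M = fst ` \<Gamma>"
    "\<And>N. closed N \<Longrightarrow> N \<subseteq> M \<Longrightarrow> fst ` N = fst ` \<Gamma> \<Longrightarrow> N = M"
proof -
  define A where "A = {M. closed M \<and> M \<subseteq> \<Gamma> \<and> fst ` M = fst ` \<Gamma>}"
  have "\<exists>m\<in>A. \<forall>a\<in>A. a \<subseteq> m \<longrightarrow> a = m"
  proof (rule predicate_Zorn)
    show "partial_order_on A (relation_of (\<lambda>x y. y \<subseteq> x) A)"
      by (rule partial_order_on_relation_ofI) auto
    fix C assume C: "C \<in> Chains (relation_of (\<lambda>x y. y \<subseteq> x) A)"
    show "\<exists>u\<in>A. \<forall>a\<in>C. u \<subseteq> a"
    proof (cases "C = {}")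
      case True
      then show ?thesis using cl by (auto simp: A_def)
    next
      case False
      have CA: "C \<subseteq> A" and lin: "\<And>q r. q \<in> C \<Longrightarrow> r \<in> C \<Longrightarrow> q \<subseteq> r \<or> r \<subseteq> q"
        using C unfolding Chains_def relation_of_def by auto
      have ne: "\<exists>k. (x, k) \<in> \<Inter>C" if x: "x \<in> fst ` \<Gamma>" for x
      proof -
        have "K \<inter> (\<Inter>M\<in>C. Pair x -` M) \<noteq> {}"
        proof (rule compact_imp_fip_image[OF K])
          fix M assume "M \<in> C"
          then have "closed M" using CA by (auto simp: A_def)
          then show "closed (Pair x -` M)"
            by (intro closed_vimage continuous_intros)
        next
          fix F assume F: "finite F" "F \<subseteq> C"
          have "\<exists>N\<in>C. \<forall>M\<in>F. N \<subseteq> M" using F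
          proof (induction F)
            case empty then show ?case using False by blast
          next
            case (insert M F)
            then obtain N where "N \<in> C" "\<forall>M\<in>F. N \<subseteq> M" by blast
            then show ?case using lin[of M N] insert.prems by blast
          qed
          then obtain N where N: "N \<in> C" "\<forall>M\<in>F. N \<subseteq> M" by blast
          then have NA: "N \<subseteq> \<Gamma>" "fst ` N = fst ` \<Gamma>" using CA unfolding A_def by blast+
          then obtain k where "(x, k) \<in> N" using x by force
          then have "k \<in> K \<inter> (\<Inter>M\<in>F. Pair x -` M)" using N NA sub by auto
          then show "K \<inter> (\<Inter>M\<in>F. Pair x -` M) \<noteq> {}" by blast
        qed
        then show ?thesis by auto
      qed
      have "\<Inter>C \<subseteq> \<Gamma>" using False CA by (auto simp: A_def)
      moreover have "fst ` \<Inter>C = fst ` \<Gamma>"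
      proof
        show "fst ` \<Inter>C \<subseteq> fst ` \<Gamma>" using \<open>\<Inter>C \<subseteq> \<Gamma>\<close> by (rule image_mono)
        show "fst ` \<Gamma> \<subseteq> fst ` \<Inter>C"
        proof
          fix x assume "x \<in> fst ` \<Gamma>"
          then obtain k where "(x, k) \<in> \<Inter>C" using ne by blast
          then show "x \<in> fst ` \<Inter>C" by (rule rev_image_eqI) simp
        qed
      qed
      moreover have "closed (\<Inter>C)" using CA by (intro closed_Inter) (auto simp: A_def)
      ultimately have "\<Inter>C \<in> A" by (simp add: A_def)
      then show ?thesis by blast
    qed
  qed
  then obtain m where m: "m \<in> A" "\<And>a. a \<in> A \<Longrightarrow> a \<subseteq> m \<Longrightarrow> a = m" by blast
  show ?thesis
  proof
    show "closed m" "m \<subseteq> \<Gamma>" "fst ` m = fst ` \<Gamma>" using m(1) by (simp_all add: A_def)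
    fix N assume N: "closed N" "N \<subseteq> m" "fst ` N = fst ` \<Gamma>"
    then have "N \<in> A" using \<open>m \<subseteq> \<Gamma>\<close> by (auto simp: A_def)
    then show "N = m" using m(2) N(2) by blast
  qed
qed

text \<open>
  Let \<open>M\<close> be a minimal closed subrelation of \<open>\<Gamma>\<close> with the same domain. If an open box \<open>B \<times> V\<close> meets
  \<open>M\<close>, then some fibre of \<open>M\<close> over \<open>B\<close> is contained in \<open>V\<close>, as otherwise removing the box from \<open>M\<close>
  would leave the domain unchanged. The points whose fibre is contained in \<open>V\<close> form a relatively
  open set, because projection along a compact factor is closed. Choosing \<open>V\<close> so that \<open>V\<close> cuts a small
  subset from the values of \<open>M\<close> over \<open>B\<close> yields a relatively open set on which \<open>\<Gamma>\<close> has a selection with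
  small range.
\<close>

lemma fragmented_selection:
  fixes \<Gamma> :: "('a::topological_space \<times> 'b::topological_space) set"
  assumes K: "compact K" and cl: "closed \<Gamma>" and sub: "\<Gamma> \<subseteq> UNIV \<times> K"
    and frag: "\<And>S. S \<subseteq> K \<Longrightarrow> S \<noteq> {} \<Longrightarrow> \<exists>V. open V \<and> V \<inter> S \<noteq> {} \<and> D (V \<inter> S)"
    and B: "open B" "B \<inter> fst ` \<Gamma> \<noteq> {}"
  shows "\<exists>U T. open U \<and> U \<subseteq> B \<and> U \<inter> fst ` \<Gamma> \<noteq> {} \<and> D T \<and>
    (\<forall>x\<in>U \<inter> fst ` \<Gamma>. \<exists>k\<in>T. (x, k) \<in> \<Gamma>)"
proof -
  obtain M where M: "closed M" "M \<subseteq> \<Gamma>" "fst ` M = fst ` \<Gamma>"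
    and min: "\<And>N. closed N \<Longrightarrow> N \<subseteq> M \<Longrightarrow> fst ` N = fst ` \<Gamma> \<Longrightarrow> N = M"
    using minimal_closed_relation[OF K cl sub] by blast
  define S where "S = snd ` (M \<inter> B \<times> UNIV)"
  have "S \<subseteq> K" using M sub by (auto simp: S_def)
  moreover have "S \<noteq> {}"
  proof -
    obtain x where "x \<in> B" "x \<in> fst ` M" using B M(3) by blast
    then obtain k where "(x, k) \<in> M \<inter> B \<times> UNIV" by force
    then show ?thesis unfolding S_def by blast
  qed
  ultimately obtain V where V: "open V" "V \<inter> S \<noteq> {}" "D (V \<inter> S)" using frag by blast
  define F where "F = fst ` (M - UNIV \<times> V)"
  have "closed (M - UNIV \<times> V)" using M V by (intro closed_Diff open_Times) auto
  then have clF: "closed F" unfolding F_def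
    by (rule closed_projection_compact[OF K]) (use M sub in auto)
  define U where "U = B - F"
  have "closed (M - B \<times> V)" using M V B by (intro closed_Diff open_Times) auto
  moreover have "M - B \<times> V \<noteq> M"
  proof -
    obtain x k where "(x, k) \<in> M" "x \<in> B" "k \<in> V" using V(2) unfolding S_def by auto
    then show ?thesis by blast
  qed
  ultimately have "fst ` (M - B \<times> V) \<noteq> fst ` \<Gamma>" using min[OF _ Diff_subset] by metis
  moreover have "fst ` (M - B \<times> V) \<subseteq> fst ` \<Gamma>" unfolding M(3)[symmetric] by (rule image_mono) simp
  ultimately obtain x where x: "x \<in> fst ` M" "x \<notin> fst ` (M - B \<times> V)" unfolding M(3)[symmetric] by auto
  have "x \<in> U"
  proof -
    obtain k where k: "(x, k) \<in> M" using x(1) by force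
    then have "x \<in> B" using x(2) by force
    moreover have "x \<notin> F" unfolding F_def using x(2) by force
    ultimately show ?thesis by (simp add: U_def)
  qed
  show ?thesis
  proof (intro exI conjI ballI)
    show "open U" unfolding U_def using B clF by blast
    show "U \<subseteq> B" by (auto simp: U_def)
    show "U \<inter> fst ` \<Gamma> \<noteq> {}" using \<open>x \<in> U\<close> x(1) M(3) by blast
    show "D (V \<inter> S)" by fact
    fix y assume y: "y \<in> U \<inter> fst ` \<Gamma>"
    then obtain k where k: "(y, k) \<in> M" using M(3) by force
    have yB: "y \<in> B" "y \<notin> F" using y by (auto simp: U_def)
    then have "k \<in> V" using k unfolding F_def by force
    moreover have "k \<in> S" using k yB(1) unfolding S_def by force
    ultimately show "\<exists>k\<in>V \<inter> S. (y, k) \<in> \<Gamma>" using k M(2) by blast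
  qed
qed

section \<open>Fragmentability of the dual of an Asplund space\<close>

text \<open>
  Functionals are plain functions here, so that the topology of pointwise convergence on the function
  type is the weak-star topology.
\<close>

definition dual_ball :: "real \<Rightarrow> ('a::real_normed_vector \<Rightarrow> real) set" where
  "dual_ball K = {\<phi>. linear \<phi> \<and> (\<forall>x. \<bar>\<phi> x\<bar> \<le> K * norm x)}"

lemma closed_linear: "closed {\<phi> :: 'a::real_vector \<Rightarrow> real. linear \<phi>}"
proof -
  have c[continuous_intros]: "continuous_on UNIV (\<lambda>\<phi> :: 'a \<Rightarrow> real. \<phi> x)" for x by simp
  have "{\<phi> :: 'a \<Rightarrow> real. linear \<phi>} =
    (\<Inter>x. \<Inter>y. {\<phi>. \<phi> (x + y) = \<phi> x + \<phi> y}) \<inter> (\<Inter>c. \<Inter>x. {\<phi>. \<phi> (c *\<^sub>R x) = c * \<phi> x})"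
    by (auto simp: linear_iff)
  also have "closed \<dots>"
    by (intro closed_Int closed_INT ballI closed_Collect_eq continuous_intros)
  finally show ?thesis .
qed

lemma closed_dual_ball: "closed (dual_ball K :: ('a::real_normed_vector \<Rightarrow> real) set)"
proof -
  have c: "continuous_on UNIV (\<lambda>\<phi> :: 'a \<Rightarrow> real. \<phi> x)" for x by simp
  have "dual_ball K = {\<phi>. linear \<phi>} \<inter> (\<Inter>x::'a. {\<phi>. \<bar>\<phi> x\<bar> \<le> K * norm x})"
    by (auto simp: dual_ball_def)
  also have "closed \<dots>"
    by (intro closed_Int closed_linear closed_INT ballI closed_Collect_le continuous_intros c)
  finally show ?thesis .
qed

text \<open>The Banach--Alaoglu theorem.\<close>

lemma compact_dual_ball: "compact (dual_ball K :: ('a::real_normed_vector \<Rightarrow> real) set)"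
proof -
  have "compactin (product_topology (\<lambda>_. euclidean) UNIV)
      (PiE UNIV (\<lambda>x::'a. {- (K * norm x)..K * norm x}))"
    unfolding compactin_PiE by simp
  then have "compact (PiE UNIV (\<lambda>x::'a. {- (K * norm x)..K * norm x}))"
    by (simp add: euclidean_product_topology)
  moreover have "dual_ball K = PiE UNIV (\<lambda>x::'a. {- (K * norm x)..K * norm x}) \<inter> {\<phi>. linear \<phi>}"
    by (auto simp: dual_ball_def PiE_iff abs_le_iff minus_le_iff)
  ultimately show ?thesis using closed_linear by (metis compact_Int_closed)
qed

lemma restrict_dual_ball_in_subspace_dual:
  assumes "\<phi> \<in> dual_ball K" "subspace Y"
  shows "restrict \<phi> Y \<in> subspace_dual Y"
  using assms
  by (auto simp: dual_ball_def subspace_dual_def subspace_add subspace_scale linear_add linear_cmul)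

text \<open>
  The closure of the set of rational linear combinations of \<open>D\<close>.
\<close>

lemma separable_subspace_containing:
  fixes D :: "'a::real_normed_vector set"
  assumes "countable D"
  obtains Y where "subspace Y" "D \<subseteq> Y" "separable_space (top_of_set Y)"
proof -
  define E where "E = (\<lambda>xs. \<Sum>(q, d)\<leftarrow>xs. real_of_rat q *\<^sub>R d) ` lists (UNIV \<times> D)"
  have "countable E" unfolding E_def using assms by (intro countable_image countable_lists) auto
  have add: "x + y \<in> E" if xy: "x \<in> E" "y \<in> E" for x y
  proof -
    obtain xs where xs: "x = (\<Sum>(q, d)\<leftarrow>xs. real_of_rat q *\<^sub>R d)" "xs \<in> lists (UNIV \<times> D)"
      using xy(1) unfolding E_def by (rule imageE)
    obtain ys where ys: "y = (\<Sum>(q, d)\<leftarrow>ys. real_of_rat q *\<^sub>R d)" "ys \<in> lists (UNIV \<times> D)"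
      using xy(2) unfolding E_def by (rule imageE)
    show ?thesis unfolding E_def
      by (rule image_eqI[of _ _ "xs @ ys"]) (use xs ys in auto)
  qed
  have scale: "real_of_rat q *\<^sub>R x \<in> E" if x: "x \<in> E" for x q
  proof -
    obtain xs where xs: "x = (\<Sum>(q, d)\<leftarrow>xs. real_of_rat q *\<^sub>R d)" "xs \<in> lists (UNIV \<times> D)"
      using x unfolding E_def by (rule imageE)
    have "real_of_rat q *\<^sub>R (\<Sum>(q, d)\<leftarrow>xs. real_of_rat q *\<^sub>R d) =
      (\<Sum>(q, d)\<leftarrow>map (\<lambda>(r, d). (q * r, d)) xs. real_of_rat q *\<^sub>R d)"
      by (induction xs) (auto simp: scaleR_add_right of_rat_mult)
    moreover have "map (\<lambda>(r, d). (q * r, d)) xs \<in> lists (UNIV \<times> D)" using xs(2) by auto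
    ultimately show ?thesis using xs(1) unfolding E_def by (simp only: image_eqI)
  qed
  have zero: "0 \<in> E" unfolding E_def by (rule image_eqI[of _ _ "[]"]) auto
  have "subspace (closure E)"
  proof (rule subspaceI)
    show "0 \<in> closure E" using zero closure_subset by blast
  next
    fix x y assume "x \<in> closure E" "y \<in> closure E"
    then obtain f g where "\<And>n. f n \<in> E" "f \<longlonglongrightarrow> x" "\<And>n. g n \<in> E" "g \<longlonglongrightarrow> y"
      unfolding closure_sequential by blast
    then have "(\<lambda>n. f n + g n) \<longlonglongrightarrow> x + y" "\<And>n. f n + g n \<in> E"
      using tendsto_add add by auto
    then show "x + y \<in> closure E" unfolding closure_sequential by (intro exI[of _ "\<lambda>n. f n + g n"]) auto
  next
    fix c :: real and x assume "x \<in> closure E"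
    then obtain f where f: "\<And>n. f n \<in> E" "f \<longlonglongrightarrow> x" unfolding closure_sequential by blast
    have "c \<in> closure \<rat>" by (simp add: Rats_closure_real)
    then obtain r where r: "\<And>n. r n \<in> \<rat>" "r \<longlonglongrightarrow> c" unfolding closure_sequential by blast
    have "(\<lambda>n. r n *\<^sub>R f n) \<longlonglongrightarrow> c *\<^sub>R x" using f r by (intro tendsto_scaleR)
    moreover have "r n *\<^sub>R f n \<in> E" for n using r(1)[of n] f(1)[of n] scale by (auto elim!: Rats_cases)
    ultimately show "c *\<^sub>R x \<in> closure E" unfolding closure_sequential
      by (intro exI[of _ "\<lambda>n. r n *\<^sub>R f n"]) auto
  qed
  moreover have "D \<subseteq> closure E"
  proof
    fix d assume "d \<in> D"
    then have "d \<in> E" unfolding E_def by (intro image_eqI[of _ _ "[(1, d)]"]) auto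
    then show "d \<in> closure E" using closure_subset by blast
  qed
  moreover have "separable_space (top_of_set (closure E))"
    unfolding separable_space_def
    by (rule exI[of _ E]) (use \<open>countable E\<close> closure_subset in \<open>auto simp: closure_of_subtopology Int_absorb1\<close>)
  ultimately show ?thesis using that by blast
qed

lemma uncountable_binary_sequences: "uncountable (UNIV :: (nat \<Rightarrow> bool) set)"
proof
  assume c: "countable (UNIV :: (nat \<Rightarrow> bool) set)"
  define d where "d n \<longleftrightarrow> \<not> from_nat_into (UNIV :: (nat \<Rightarrow> bool) set) n n" for n
  obtain n where "from_nat_into UNIV n = d" using from_nat_into_surj[OF c, of d] by blast
  then show False using d_def[of n] by simp
qed

text \<open>
  If every nonempty relatively weak-star open subset of \<open>S\<close> had diameter greater than \<open>e\<close>, each such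
  set \<open>V \<inter> S\<close> could be split: two of its elements differ by more than \<open>e\<close> at a unit vector \<open>u\<close>, and the
  open conditions \<open>\<theta> u < a\<close> and \<open>\<theta> u > a + e\<close> cut out two smaller sets. Iterating gives a binary tree
  of open sets. By compactness each branch has a limit functional, and the limits of
  two distinct branches differ by at least \<open>e\<close> at the vector of the node where the branches part.
  There are only countably many such vectors, so they lie in a separable subspace \<open>Y\<close>, on whose dual
  uncountably many restricted functionals are at mutual distance at least \<open>e\<close>. Hence the dual of \<open>Y\<close>
  is not separable.
\<close>

lemma asplund_dual_ball_fragmented:
  fixes S :: "('a::banach \<Rightarrow> real) set"
  assumes asplund: "asplund_space TYPE('a)" and SK: "S \<subseteq> dual_ball K" and "S \<noteq> {}" and e: "e > 0"
  shows "\<exists>V. open V \<and> V \<inter> S \<noteq> {} \<and> (\<forall>\<phi>\<in>V \<inter> S. \<forall>\<psi>\<in>V \<inter> S. \<forall>u. \<bar>\<phi> u - \<psi> u\<bar> \<le> e * norm u)"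
proof (rule ccontr)
  assume neg: "\<not> ?thesis"
  define good where "good V \<longleftrightarrow> open V \<and> V \<inter> S \<noteq> {}" for V
  have cont: "continuous_on UNIV (\<lambda>\<phi> :: 'a \<Rightarrow> real. \<phi> x)" for x by simp
  have split: "\<exists>V' u a. (\<forall>b. good (V' b) \<and> V' b \<subseteq> V) \<and> norm u \<le> 1 \<and>
      (\<forall>\<theta>\<in>V' False. \<theta> u \<le> a) \<and> (\<forall>\<theta>\<in>V' True. a + e \<le> \<theta> u)" if V: "good V" for V
  proof -
    obtain \<phi> \<psi> u where *: "\<phi> \<in> V \<inter> S" "\<psi> \<in> V \<inter> S" "\<phi> u - \<psi> u > e * norm u"
    proof -
      obtain \<phi> \<psi> u where *: "\<phi> \<in> V \<inter> S" "\<psi> \<in> V \<inter> S" "\<bar>\<phi> u - \<psi> u\<bar> > e * norm u"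
      proof -
        have "\<exists>\<phi>\<in>V \<inter> S. \<exists>\<psi>\<in>V \<inter> S. \<exists>u. \<not> \<bar>\<phi> u - \<psi> u\<bar> \<le> e * norm u"
          using V neg unfolding good_def by blast
        then show ?thesis using that by (auto simp: not_le)
      qed
      then consider "\<phi> u - \<psi> u > e * norm u" | "\<psi> u - \<phi> u > e * norm u" by linarith
      then show ?thesis using * that by cases blast+
    qed
    have lin: "linear \<phi>" "linear \<psi>" using * SK by (auto simp: dual_ball_def)
    have "u \<noteq> 0" using *(3) lin by (auto simp: linear_0)
    define v where "v = inverse (norm u) *\<^sub>R u"
    have "norm u * (\<phi> v - \<psi> v) = \<phi> u - \<psi> u"
      using lin \<open>u \<noteq> 0\<close> by (simp add: v_def linear_cmul field_simps)
    then have "norm u * e < norm u * (\<phi> v - \<psi> v)" using *(3) by (simp add: mult.commute)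
    then have gap: "\<phi> v - \<psi> v > e" using \<open>u \<noteq> 0\<close> by (simp add: mult_less_cancel_left_pos)
    define a where "a = (\<phi> v + \<psi> v - e) / 2"
    define V' where "V' b = V \<inter> (if b then {\<theta>. a + e < \<theta> v} else {\<theta>. \<theta> v < a})" for b
    have "open (V' b)" for b
      using V cont by (auto simp: V'_def good_def intro!: open_Int open_Collect_less continuous_intros)
    moreover have "\<phi> \<in> V' True \<inter> S" "\<psi> \<in> V' False \<inter> S"
      using * gap by (auto simp: V'_def a_def field_simps)
    ultimately have "good (V' b)" for b unfolding good_def by (cases b) auto
    moreover have "norm v \<le> 1" using \<open>u \<noteq> 0\<close> by (simp add: v_def)
    ultimately show ?thesis by (intro exI[of _ V'] exI[of _ v] exI[of _ a]) (auto simp: V'_def)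
  qed
  then have "\<forall>V. \<exists>V' u a. good V \<longrightarrow> (\<forall>b. good (V' b) \<and> V' b \<subseteq> V) \<and> norm u \<le> 1 \<and>
      (\<forall>\<theta>\<in>V' False. \<theta> u \<le> a) \<and> (\<forall>\<theta>\<in>V' True. a + e \<le> \<theta> u)" by meson
  then obtain s u a where s: "\<And>V b. good V \<Longrightarrow> good (s V b)" "\<And>V b. good V \<Longrightarrow> s V b \<subseteq> V"
    and u: "\<And>V. good V \<Longrightarrow> norm (u V) \<le> 1"
    and a: "\<And>V \<theta>. good V \<Longrightarrow> \<theta> \<in> s V False \<Longrightarrow> \<theta> (u V) \<le> a V"
      "\<And>V \<theta>. good V \<Longrightarrow> \<theta> \<in> s V True \<Longrightarrow> a V + e \<le> \<theta> (u V)"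
    unfolding choice_iff by blast
  \<comment> \<open>the node at depth \<open>n\<close> on the branch \<open>\<sigma>\<close>\<close>
  define N where "N \<sigma> n = foldl s UNIV (map \<sigma> [0..<n])" for \<sigma> :: "nat \<Rightarrow> bool" and n
  have N_Suc: "N \<sigma> (Suc n) = s (N \<sigma> n) (\<sigma> n)" for \<sigma> n by (simp add: N_def)
  have goodN: "good (N \<sigma> n)" for \<sigma> n
  proof (induction n)
    case 0 then show ?case using \<open>S \<noteq> {}\<close> by (simp add: N_def good_def)
  next
    case (Suc n) then show ?case using s(1) by (simp add: N_Suc)
  qed
  have dec: "decseq (N \<sigma>)" for \<sigma>
    by (rule decseq_SucI) (use s(2) goodN in \<open>simp add: N_Suc\<close>)
  have "\<exists>\<phi>\<in>dual_ball K. \<forall>n. \<phi> \<in> closure (N \<sigma> n)" for \<sigma>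
  proof -
    have "dual_ball K \<inter> (\<Inter>n\<in>UNIV. closure (N \<sigma> n)) \<noteq> {}"
    proof (rule compact_imp_fip_image[OF compact_dual_ball])
      fix I :: "nat set" assume "finite I"
      then obtain m where m: "I \<subseteq> {..m}" using finite_nat_iff_bounded_le by blast
      obtain \<phi> where \<phi>: "\<phi> \<in> N \<sigma> m" "\<phi> \<in> S" using goodN[of \<sigma> m] unfolding good_def by blast
      have "N \<sigma> m \<subseteq> closure (N \<sigma> i)" if "i \<in> I" for i
        using decseqD[OF dec, of i m \<sigma>] m that closure_subset by fastforce
      then show "dual_ball K \<inter> (\<Inter>n\<in>I. closure (N \<sigma> n)) \<noteq> {}" using \<phi> SK by blast
    qed auto
    then show ?thesis by blast
  qed
  then obtain \<Phi> where \<Phi>: "\<And>\<sigma>. \<Phi> \<sigma> \<in> dual_ball K" "\<And>\<sigma> n. \<Phi> \<sigma> \<in> closure (N \<sigma> n)" by metis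
  have below: "\<Phi> \<sigma> (u (N \<sigma> n)) \<le> a (N \<sigma> n)" if "\<not> \<sigma> n" for \<sigma> n
  proof -
    have "N \<sigma> (Suc n) \<subseteq> {\<theta>. \<theta> (u (N \<sigma> n)) \<le> a (N \<sigma> n)}" using a(1)[OF goodN] that by (auto simp: N_Suc)
    moreover have "closed {\<theta>. \<theta> (u (N \<sigma> n)) \<le> a (N \<sigma> n)}"
      using cont by (intro closed_Collect_le continuous_intros)
    ultimately show ?thesis using \<Phi>(2)[of \<sigma> "Suc n"] closure_minimal by blast
  qed
  have above: "a (N \<sigma> n) + e \<le> \<Phi> \<sigma> (u (N \<sigma> n))" if "\<sigma> n" for \<sigma> n
  proof -
    have "N \<sigma> (Suc n) \<subseteq> {\<theta>. a (N \<sigma> n) + e \<le> \<theta> (u (N \<sigma> n))}" using a(2)[OF goodN] that by (auto simp: N_Suc)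
    moreover have "closed {\<theta>. a (N \<sigma> n) + e \<le> \<theta> (u (N \<sigma> n))}"
      using cont by (intro closed_Collect_le continuous_intros)
    ultimately show ?thesis using \<Phi>(2)[of \<sigma> "Suc n"] closure_minimal by blast
  qed
  define D where "D = range (\<lambda>xs. u (foldl s UNIV xs))"
  have "countable D" unfolding D_def by simp
  then obtain Y where Y: "subspace Y" "D \<subseteq> Y" "separable_space (top_of_set Y)"
    using separable_subspace_containing by blast
  interpret Metric_space "subspace_dual Y" "subspace_dual_dist Y"
    by (rule Metric_space_subspace_dual[OF Y(1)])
  define R where "R \<sigma> = restrict (\<Phi> \<sigma>) Y" for \<sigma>
  have R: "R \<sigma> \<in> subspace_dual Y" for \<sigma>
    unfolding R_def by (rule restrict_dual_ball_in_subspace_dual[OF \<Phi>(1) Y(1)])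
  have far: "e \<le> subspace_dual_dist Y (R \<sigma>) (R \<tau>)" if "\<sigma> \<noteq> \<tau>" for \<sigma> \<tau>
  proof -
    define n where "n = (LEAST n. \<sigma> n \<noteq> \<tau> n)"
    have n: "\<sigma> n \<noteq> \<tau> n" unfolding n_def by (rule LeastI_ex) (use that in auto)
    have "\<tau> i = \<sigma> i" if "i < n" for i using not_less_Least[of i] that unfolding n_def by blast
    then have "map \<tau> [0..<n] = map \<sigma> [0..<n]" by simp
    then have Neq: "N \<tau> n = N \<sigma> n" unfolding N_def by (simp only:)
    define w where "w = u (N \<sigma> n)"
    have w: "w \<in> Y" "norm w \<le> 1" using Y(2) u[OF goodN] by (auto simp: w_def D_def N_def)
    have "e \<le> \<bar>\<Phi> \<sigma> w - \<Phi> \<tau> w\<bar>"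
      using below[of \<sigma> n] above[of \<sigma> n] below[of \<tau> n] above[of \<tau> n] n
      unfolding Neq w_def by linarith
    also have "\<dots> = \<bar>R \<sigma> w - R \<tau> w\<bar>" using w by (simp add: R_def)
    also have "\<dots> \<le> subspace_dual_dist Y (R \<sigma>) (R \<tau>)"
      by (rule subspace_dual_dist_upper[OF R R w])
    finally show ?thesis .
  qed
  obtain C where C: "countable C" "C \<subseteq> subspace_dual Y" "mtopology closure_of C = subspace_dual Y"
  proof -
    have "separable_space mtopology" using asplund Y(1,3) unfolding asplund_space_def by blast
    then show ?thesis using that unfolding separable_space_def topspace_mtopology by blast
  qed
  have "\<exists>c\<in>C. subspace_dual_dist Y (R \<sigma>) c < e / 2" for \<sigma>
  proof -
    have "R \<sigma> \<in> mtopology closure_of C" using R C(3) by simp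
    moreover have "e / 2 > 0" using e by simp
    ultimately obtain y where "y \<in> C" "y \<in> mball (R \<sigma>) (e / 2)" unfolding metric_closure_of by blast
    then show ?thesis by (intro bexI[of _ y]) simp_all
  qed
  then obtain c where c: "\<And>\<sigma>. c \<sigma> \<in> C" "\<And>\<sigma>. subspace_dual_dist Y (R \<sigma>) (c \<sigma>) < e / 2" by metis
  have "inj c"
  proof (rule injI, rule ccontr)
    fix \<sigma> \<tau> assume eq: "c \<sigma> = c \<tau>" and "\<sigma> \<noteq> \<tau>"
    then have "e \<le> subspace_dual_dist Y (R \<sigma>) (R \<tau>)" using far by blast
    also have "\<dots> \<le> subspace_dual_dist Y (R \<sigma>) (c \<sigma>) + subspace_dual_dist Y (c \<sigma>) (R \<tau>)"
      using triangle R C(2) c(1) by blast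
    also have "subspace_dual_dist Y (c \<sigma>) (R \<tau>) = subspace_dual_dist Y (R \<tau>) (c \<tau>)"
      using eq by (simp add: commute)
    also have "subspace_dual_dist Y (R \<sigma>) (c \<sigma>) + \<dots> < e" using c(2)[of \<sigma>] c(2)[of \<tau>] by linarith
    finally show False by simp
  qed
  moreover have "countable (range c)" using countable_subset[OF _ C(1)] c(1) by blast
  ultimately have "countable (UNIV :: (nat \<Rightarrow> bool) set)" using countable_image_inj_on by blast
  then show False using uncountable_binary_sequences by blast
qed

section \<open>Subgradients of approximately convex functions\<close>

definition eps_convex_on :: "'a::real_normed_vector set \<Rightarrow> ('a \<Rightarrow> real) \<Rightarrow> real \<Rightarrow> bool" where
  "eps_convex_on S f \<epsilon> \<longleftrightarrow>
    (\<forall>l\<in>{0..1}. \<forall>x\<in>S. \<forall>y\<in>S.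
      f (l *\<^sub>R x + (1 - l) *\<^sub>R y) \<le> l * f x + (1 - l) * f y + \<epsilon> * l * (1 - l) * norm (x - y))"

text \<open>
  A subgradient up to the slope error \<open>\<epsilon>\<close>, valid on all of \<open>S\<close> and not only in the limit at \<open>x\<close>. The
  defining inequality passes to weak-star limits, which makes graphs of such subgradients closed.
\<close>

definition eps_subgradient ::
    "'a::real_normed_vector set \<Rightarrow> ('a \<Rightarrow> real) \<Rightarrow> real \<Rightarrow> 'a \<Rightarrow> ('a \<Rightarrow> real) \<Rightarrow> bool" where
  "eps_subgradient S f \<epsilon> x \<phi> \<longleftrightarrow> (\<forall>w\<in>S. \<phi> (w - x) \<le> f w - f x + \<epsilon> * norm (w - x))"

lemma eps_convex_on_subset: "eps_convex_on S f \<epsilon> \<Longrightarrow> T \<subseteq> S \<Longrightarrow> eps_convex_on T f \<epsilon>"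
  unfolding eps_convex_on_def by (meson subsetD)

lemma approximately_convex_at_eps_convex:
  assumes "approximately_convex_at G f x" "\<epsilon> > 0"
  obtains \<delta> where "\<delta> > 0" "ball x \<delta> \<subseteq> G" "eps_convex_on (ball x \<delta>) f \<epsilon>"
  using assms unfolding approximately_convex_at_def eps_convex_on_def by meson

lemma bounded_linear_dual_ball: "\<phi> \<in> dual_ball K \<Longrightarrow> bounded_linear \<phi>"
  unfolding dual_ball_def
  by (intro bounded_linear_intro[of _ K]) (auto simp: linear_add linear_cmul mult.commute)

text \<open>
  The argument for convex functions: extend the segment from \<open>x\<close> to \<open>y\<close> beyond \<open>y\<close> by length \<open>r\<close> to
  a point \<open>z\<close> and use convexity between \<open>x\<close> and \<open>z\<close>.
\<close>

lemma eps_convex_bounded_imp_lipschitz: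
  fixes f :: "'a::real_normed_vector \<Rightarrow> real"
  assumes conv: "eps_convex_on (ball x0 (2 * r)) f \<epsilon>" and "\<epsilon> \<ge> 0" and r: "r > 0"
    and M: "\<And>y. y \<in> ball x0 (2 * r) \<Longrightarrow> \<bar>f y\<bar> \<le> M"
    and xy: "x \<in> ball x0 r" "y \<in> ball x0 r"
  shows "\<bar>f y - f x\<bar> \<le> (2 * M / r + \<epsilon>) * norm (y - x)"
proof -
  have one: "f y - f x \<le> (2 * M / r + \<epsilon>) * norm (y - x)" if xy: "x \<in> ball x0 r" "y \<in> ball x0 r" for x y
  proof (cases "x = y")
    case False
    define d where "d = norm (y - x)"
    have d: "d > 0" using False by (simp add: d_def)
    define z where "z = y + (r / d) *\<^sub>R (y - x)"
    define l where "l = d / (r + d)"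
    have l: "0 \<le> l" "l \<le> 1" "l * (r + d) = d" "l \<le> d / r"
      using d r by (auto simp: l_def field_simps)
    have "norm (z - y) = r" using d r by (simp add: z_def d_def)
    then have z: "z \<in> ball x0 (2 * r)"
      using xy(2) dist_triangle[of x0 z y] by (simp add: dist_norm norm_minus_commute)
    have x: "x \<in> ball x0 (2 * r)" using xy(1) r by simp
    have "1 + r / d = (r + d) / d" using d by (simp add: add_divide_distrib)
    then have "l * (1 + r / d) = 1" using d r by (simp add: l_def)
    then have ly: "l + l * (r / d) = 1" by (simp add: distrib_left)
    have "l *\<^sub>R z + (1 - l) *\<^sub>R x = (l + l * (r / d)) *\<^sub>R y + (1 - (l + l * (r / d))) *\<^sub>R x"
      by (simp add: z_def algebra_simps)
    then have eq: "l *\<^sub>R z + (1 - l) *\<^sub>R x = y" unfolding ly by simp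
    have "z - x = (1 + r / d) *\<^sub>R (y - x)" by (simp add: z_def algebra_simps)
    then have "norm (z - x) = (1 + r / d) * d" using d r by (simp add: d_def)
    also have "\<dots> = r + d" using d by (simp add: field_simps)
    finally have nzx: "norm (z - x) = r + d" .
    have "f y \<le> l * f z + (1 - l) * f x + \<epsilon> * l * (1 - l) * norm (z - x)"
      using conv[unfolded eps_convex_on_def, rule_format, of l z x] l z x unfolding eq by simp
    also have "\<epsilon> * l * (1 - l) * norm (z - x) = \<epsilon> * (1 - l) * (l * (r + d))"
      unfolding nzx by (simp add: mult_ac)
    also have "\<dots> = \<epsilon> * ((1 - l) * d)" unfolding l(3) by simp
    also have "\<dots> \<le> \<epsilon> * (1 * d)"
      using l d \<open>\<epsilon> \<ge> 0\<close> by (intro mult_left_mono mult_right_mono) auto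
    finally have "f y - f x \<le> l * (f z - f x) + \<epsilon> * d" by (simp add: algebra_simps)
    also have "l * (f z - f x) \<le> (d / r) * (2 * M)"
    proof (rule order_trans)
      show "l * (f z - f x) \<le> l * (2 * M)"
        using l M[OF z] M[OF x] by (intro mult_left_mono) auto
      have "0 \<le> M" using M[OF x] by linarith
      then show "l * (2 * M) \<le> (d / r) * (2 * M)" using l by (intro mult_right_mono) auto
    qed
    finally show ?thesis by (simp add: d_def algebra_simps)
  qed simp
  show ?thesis using one[OF xy] one[OF xy(2) xy(1)] by (simp add: norm_minus_commute)
qed

lemma approximately_convex_locally_lipschitz:
  fixes f :: "'a::real_normed_vector \<Rightarrow> real"
  assumes conv: "approximately_convex_at G f x0" and G: "open G" "x0 \<in> G" and cont: "continuous_on G f"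
    and \<epsilon>: "\<epsilon> > 0"
  obtains r K where "r > 0" "ball x0 r \<subseteq> G" "eps_convex_on (ball x0 r) f \<epsilon>"
    "\<And>x y. x \<in> ball x0 r \<Longrightarrow> y \<in> ball x0 r \<Longrightarrow> \<bar>f y - f x\<bar> \<le> K * norm (y - x)"
proof -
  obtain \<delta> where \<delta>: "\<delta> > 0" "ball x0 \<delta> \<subseteq> G" "eps_convex_on (ball x0 \<delta>) f \<epsilon>"
    using approximately_convex_at_eps_convex[OF conv \<epsilon>] .
  have "isCont f x0" using cont G by (simp add: continuous_on_eq_continuous_at)
  then obtain \<eta> where \<eta>: "\<eta> > 0" "\<And>y. dist y x0 < \<eta> \<Longrightarrow> dist (f y) (f x0) < 1"
    unfolding continuous_at_eps_delta by (meson zero_less_one)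
  define r where "r = min \<delta> \<eta> / 2"
  have r: "r > 0" "2 * r \<le> \<delta>" "2 * r \<le> \<eta>" using \<delta> \<eta> by (auto simp: r_def)
  have sub: "ball x0 (2 * r) \<subseteq> ball x0 \<delta>" "ball x0 r \<subseteq> ball x0 \<delta>" using r by (auto intro!: subset_ball)
  have M: "\<bar>f y\<bar> \<le> \<bar>f x0\<bar> + 1" if "y \<in> ball x0 (2 * r)" for y
    using \<eta>(2)[of y] that r by (auto simp: dist_commute dist_real_def)
  show ?thesis
  proof
    show "r > 0" by fact
    show "ball x0 r \<subseteq> G" using sub \<delta> by blast
    show "eps_convex_on (ball x0 r) f \<epsilon>" using eps_convex_on_subset \<delta> sub by blast
    show "\<bar>f y - f x\<bar> \<le> (2 * (\<bar>f x0\<bar> + 1) / r + \<epsilon>) * norm (y - x)"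
      if "x \<in> ball x0 r" "y \<in> ball x0 r" for x y
      using eps_convex_on_subset[OF \<delta>(3) sub(1)] \<epsilon> r(1) M that
      by (intro eps_convex_bounded_imp_lipschitz[of x0 r f \<epsilon>]) auto
  qed
qed

text \<open>
  The upper directional derivative \<open>p\<close> of \<open>f\<close> at \<open>x\<close> is finite by the Lipschitz bound, and it is
  subadditive because the error constant of approximate convexity can be made arbitrarily small near
  \<open>x\<close>. A linear functional \<open>\<phi>\<close> below \<open>p\<close> is the desired subgradient: along the segment from \<open>x\<close> to \<open>w\<close>,
  \<open>\<epsilon>\<close>-convexity bounds every difference quotient, hence also \<open>p (w - x)\<close>. One functional works for all
  \<open>S\<close> and \<open>\<epsilon>\<close> at once.
\<close>

lemma subgradient_exists:
  fixes f :: "'a::real_normed_vector \<Rightarrow> real"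
  assumes conv: "approximately_convex_at G f x" and \<rho>: "\<rho> > 0"
    and lip: "\<And>y. y \<in> ball x \<rho> \<Longrightarrow> \<bar>f y - f x\<bar> \<le> K * norm (y - x)"
  obtains \<phi> where "\<phi> \<in> dual_ball K"
    "\<And>S \<epsilon>. \<epsilon> \<ge> 0 \<Longrightarrow> x \<in> S \<Longrightarrow> eps_convex_on S f \<epsilon> \<Longrightarrow> eps_subgradient S f \<epsilon> x \<phi>"
proof -
  \<comment> \<open>the eventual upper bounds of the difference quotients in direction \<open>h\<close>; their infimum is \<open>p h\<close>\<close>
  define P where "P h = {v. \<exists>d>0. \<forall>s. 0 < s \<and> s < d \<longrightarrow> f (x + s *\<^sub>R h) - f x \<le> s * v}" for h
  have near: "\<exists>d>0. \<forall>s. 0 < s \<and> s < d \<longrightarrow> x + s *\<^sub>R h \<in> ball x \<delta>" if "\<delta> > 0" for h \<delta>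
  proof (intro exI conjI allI impI)
    show "\<delta> / (norm h + 1) > 0" using that by (intro divide_pos_pos) (auto simp: add_nonneg_pos)
    fix s assume s: "0 < s \<and> s < \<delta> / (norm h + 1)"
    have "s * norm h \<le> s * (norm h + 1)" using s by (intro mult_left_mono) auto
    also have "\<dots> < \<delta>" using s by (simp add: pos_less_divide_eq add_nonneg_pos)
    finally show "x + s *\<^sub>R h \<in> ball x \<delta>" using s by (simp add: dist_norm)
  qed
  have slip: "\<exists>d>0. \<forall>s. 0 < s \<and> s < d \<longrightarrow> \<bar>f (x + s *\<^sub>R h) - f x\<bar> \<le> s * (K * norm h)" for h
  proof -
    obtain d where d: "d > 0" "\<And>s. 0 < s \<Longrightarrow> s < d \<Longrightarrow> x + s *\<^sub>R h \<in> ball x \<rho>" using near[OF \<rho>] by blast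
    have "\<bar>f (x + s *\<^sub>R h) - f x\<bar> \<le> s * (K * norm h)" if "0 < s \<and> s < d" for s
      using lip[OF d(2)[of s]] that by (simp add: mult_ac)
    then show ?thesis using d(1) by blast
  qed
  have up: "K * norm h \<in> P h" for h
  proof -
    obtain d where "d > 0" "\<And>s. 0 < s \<Longrightarrow> s < d \<Longrightarrow> \<bar>f (x + s *\<^sub>R h) - f x\<bar> \<le> s * (K * norm h)"
      using slip by blast
    then show ?thesis unfolding P_def by (intro CollectI exI[of _ d]) (auto simp: abs_le_iff)
  qed
  have low: "- (K * norm h) \<le> v" if v: "v \<in> P h" for v h
  proof -
    obtain d where d: "d > 0" "\<And>s. 0 < s \<Longrightarrow> s < d \<Longrightarrow> \<bar>f (x + s *\<^sub>R h) - f x\<bar> \<le> s * (K * norm h)"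
      using slip by blast
    obtain d' where d': "d' > 0" "\<And>s. 0 < s \<Longrightarrow> s < d' \<Longrightarrow> f (x + s *\<^sub>R h) - f x \<le> s * v"
      using v unfolding P_def by blast
    define s where "s = min d d' / 2"
    have s: "0 < s" "s < d" "s < d'" using d(1) d'(1) by (auto simp: s_def)
    have "s * (- (K * norm h)) \<le> s * v"
      using d(2)[OF s(1,2)] d'(2)[OF s(1,3)] unfolding abs_le_iff by linarith
    then show ?thesis using s(1) by (simp only: mult_le_cancel_left_pos)
  qed
  define p where "p h = Inf (P h)" for h
  have ple: "p h \<le> v" if "v \<in> P h" for h v
    unfolding p_def using low that by (intro cInf_lower bdd_belowI) auto
  have pge: "b \<le> p h" if "\<And>v. v \<in> P h \<Longrightarrow> b \<le> v" for h b
    unfolding p_def using up that by (intro cInf_greatest) auto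
  have sum: "v + w + \<eta> \<in> P (h + k)" if v: "v \<in> P h" and w: "w \<in> P k" and \<eta>: "\<eta> > 0" for h k v w \<eta>
  proof -
    \<comment> \<open>at the midpoint of \<open>x + 2 s h\<close> and \<open>x + 2 s k\<close> the error term is \<open>e s norm (h - k) / 2\<close>,
      which is then at most \<open>s \<eta>\<close>\<close>
    define e where "e = 2 * \<eta> / (norm (h - k) + 1)"
    have e: "e > 0" "e * norm (h - k) \<le> 2 * \<eta>"
      using \<eta> by (auto simp: e_def add_nonneg_pos pos_divide_le_eq)
    obtain \<delta> where \<delta>: "\<delta> > 0" "eps_convex_on (ball x \<delta>) f e"
      using approximately_convex_at_eps_convex[OF conv e(1)] by blast
    obtain d1 where d1: "d1 > 0" "\<And>s. 0 < s \<Longrightarrow> s < d1 \<Longrightarrow> x + s *\<^sub>R h \<in> ball x \<delta>" using near[OF \<delta>(1)] by blast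
    obtain d2 where d2: "d2 > 0" "\<And>s. 0 < s \<Longrightarrow> s < d2 \<Longrightarrow> x + s *\<^sub>R k \<in> ball x \<delta>" using near[OF \<delta>(1)] by blast
    obtain d3 where d3: "d3 > 0" "\<And>s. 0 < s \<Longrightarrow> s < d3 \<Longrightarrow> f (x + s *\<^sub>R h) - f x \<le> s * v"
      using v unfolding P_def by blast
    obtain d4 where d4: "d4 > 0" "\<And>s. 0 < s \<Longrightarrow> s < d4 \<Longrightarrow> f (x + s *\<^sub>R k) - f x \<le> s * w"
      using w unfolding P_def by blast
    define d where "d = min (min d1 d2) (min d3 d4) / 2"
    have d: "d > 0" "2 * d \<le> d1" "2 * d \<le> d2" "2 * d \<le> d3" "2 * d \<le> d4"
      using d1(1) d2(1) d3(1) d4(1) by (auto simp: d_def)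
    have "f (x + s *\<^sub>R (h + k)) - f x \<le> s * (v + w + \<eta>)" if s: "0 < s" "s < d" for s
    proof -
      have s2: "0 < 2 * s" "2 * s < d1" "2 * s < d2" "2 * s < d3" "2 * s < d4" using s d by linarith+
      have eq: "(1/2) *\<^sub>R (x + (2 * s) *\<^sub>R h) + (1 - 1/2) *\<^sub>R (x + (2 * s) *\<^sub>R k) = x + s *\<^sub>R (h + k)"
      proof -
        have "(1/2) *\<^sub>R (x + (2 * s) *\<^sub>R h) + (1 - 1/2) *\<^sub>R (x + (2 * s) *\<^sub>R k) =
          ((1/2) *\<^sub>R x + (1/2) *\<^sub>R x) + s *\<^sub>R (h + k)" by (simp add: algebra_simps)
        also have "(1/2) *\<^sub>R x + (1/2) *\<^sub>R x = x" by (simp flip: scaleR_add_left)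
        finally show ?thesis .
      qed
      have "x + (2 * s) *\<^sub>R h - (x + (2 * s) *\<^sub>R k) = (2 * s) *\<^sub>R (h - k)" by (simp add: algebra_simps)
      then have nrm: "norm (x + (2 * s) *\<^sub>R h - (x + (2 * s) *\<^sub>R k)) = 2 * s * norm (h - k)"
        using s by simp
      have "f (x + s *\<^sub>R (h + k)) \<le> 1/2 * f (x + (2 * s) *\<^sub>R h) + (1 - 1/2) * f (x + (2 * s) *\<^sub>R k)
          + e * (1/2) * (1 - 1/2) * (2 * s * norm (h - k))"
        using \<delta>(2)[unfolded eps_convex_on_def, rule_format, of "1/2" "x + (2 * s) *\<^sub>R h" "x + (2 * s) *\<^sub>R k"]
          d1(2)[OF s2(1,2)] d2(2)[OF s2(1,3)] unfolding eq nrm by simp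
      moreover have "f (x + (2 * s) *\<^sub>R h) \<le> f x + 2 * s * v" using d3(2)[OF s2(1,4)] by linarith
      moreover have "f (x + (2 * s) *\<^sub>R k) \<le> f x + 2 * s * w" using d4(2)[OF s2(1,5)] by linarith
      moreover have "s * (e * norm (h - k)) \<le> s * (2 * \<eta>)" using e(2) s(1) by (intro mult_left_mono) auto
      ultimately show ?thesis by (simp add: algebra_simps)
    qed
    then show ?thesis unfolding P_def using d(1) by blast
  qed
  have "sublinear p"
  proof (rule sublinearI)
    fix h k
    show "p (h + k) \<le> p h + p k"
    proof (rule field_le_epsilon)
      fix \<eta> :: real assume "\<eta> > 0"
      then have "p (h + k) \<le> v + w + \<eta>" if "v \<in> P h" "w \<in> P k" for v w using ple sum that by blast
      then have "p (h + k) - w - \<eta> \<le> v" if "v \<in> P h" "w \<in> P k" for v w using that by (smt (verit))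
      then have "p (h + k) - w - \<eta> \<le> p h" if "w \<in> P k" for w using pge that by blast
      then have "p (h + k) - p h - \<eta> \<le> w" if "w \<in> P k" for w using that by (smt (verit))
      then have "p (h + k) - p h - \<eta> \<le> p k" using pge by blast
      then show "p (h + k) \<le> p h + p k + \<eta>" by linarith
    qed
  next
    fix c :: real and h
    assume c: "c > 0"
    have "p (c *\<^sub>R h) / c \<le> v" if v: "v \<in> P h" for v
    proof -
      obtain d where d: "d > 0" "\<And>s. 0 < s \<Longrightarrow> s < d \<Longrightarrow> f (x + s *\<^sub>R h) - f x \<le> s * v"
        using v unfolding P_def by blast
      have "f (x + s *\<^sub>R (c *\<^sub>R h)) - f x \<le> s * (c * v)" if s: "0 < s \<and> s < d / c" for s
        using d(2)[of "s * c"] s c by (simp add: pos_less_divide_eq mult.assoc)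
      moreover have "d / c > 0" using d c by simp
      ultimately have "c * v \<in> P (c *\<^sub>R h)" unfolding P_def by blast
      then show ?thesis using ple c by (simp add: pos_divide_le_eq mult.commute)
    qed
    then have "p (c *\<^sub>R h) / c \<le> p h" using pge by blast
    then show "p (c *\<^sub>R h) \<le> c * p h" using c by (simp add: pos_divide_le_eq mult.commute)
  qed
  then obtain \<phi> where \<phi>: "linear \<phi>" "\<And>h. \<phi> h \<le> p h" using Hahn_Banach_sublinear by blast
  have \<phi>P: "\<phi> h \<le> v" if "v \<in> P h" for h v using \<phi>(2)[of h] ple[OF that] by linarith
  show ?thesis
  proof
    have "\<phi> h \<le> K * norm h" "- \<phi> h \<le> K * norm h" for h
      using \<phi>P[OF up, of h] \<phi>P[OF up, of "- h"] \<phi>(1) by (simp_all add: linear_neg)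
    then show "\<phi> \<in> dual_ball K" using \<phi>(1) by (auto simp: dual_ball_def abs_le_iff)
  next
    fix S \<epsilon> assume \<epsilon>: "(\<epsilon>::real) \<ge> 0" and x: "x \<in> S" and S: "eps_convex_on S f \<epsilon>"
    show "eps_subgradient S f \<epsilon> x \<phi>"
      unfolding eps_subgradient_def
    proof
      fix w assume w: "w \<in> S"
      have "f (x + s *\<^sub>R (w - x)) - f x \<le> s * (f w - f x + \<epsilon> * norm (w - x))" if s: "0 < s \<and> s < 1" for s
      proof -
        have "x + s *\<^sub>R (w - x) = s *\<^sub>R w + (1 - s) *\<^sub>R x" by (simp add: algebra_simps)
        then have "f (x + s *\<^sub>R (w - x)) \<le> s * f w + (1 - s) * f x + \<epsilon> * s * (1 - s) * norm (w - x)"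
          using S[unfolded eps_convex_on_def, rule_format, of s w x] s w x by simp
        also have "\<epsilon> * s * (1 - s) * norm (w - x) \<le> \<epsilon> * s * 1 * norm (w - x)"
          using s \<epsilon> by (intro mult_right_mono mult_left_mono) auto
        finally show ?thesis by (simp add: algebra_simps)
      qed
      then have "f w - f x + \<epsilon> * norm (w - x) \<in> P (w - x)"
        unfolding P_def by (intro CollectI exI[of _ 1]) simp
      then show "\<phi> (w - x) \<le> f w - f x + \<epsilon> * norm (w - x)" by (rule \<phi>P)
    qed
  qed
qed

text \<open>
  A subgradient bounds \<open>f (x + h) - f x - \<phi> h\<close> from below for \<open>h\<close> and for \<open>- h\<close>, so smallness of the
  sum of the two expressions forces each of them to be small from above as well.
\<close>

lemma differentiable_if_symmetric:
  fixes f :: "'a::real_normed_vector \<Rightarrow> real"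
  assumes conv: "approximately_convex_at G f x" and "open G" "x \<in> G" "continuous_on G f"
    and sym: "\<And>c. c > 0 \<Longrightarrow> \<exists>\<delta>>0. \<forall>h. norm h < \<delta> \<longrightarrow> f (x + h) + f (x - h) - 2 * f x \<le> c * norm h"
  shows "f differentiable (at x)"
proof -
  obtain r K where r: "r > 0" and lip: "\<And>x' y. x' \<in> ball x r \<Longrightarrow> y \<in> ball x r \<Longrightarrow> \<bar>f y - f x'\<bar> \<le> K * norm (y - x')"
    using approximately_convex_locally_lipschitz[OF assms(1-4) zero_less_one] by metis
  obtain \<phi> where \<phi>: "\<phi> \<in> dual_ball K"
    "\<And>S \<epsilon>. \<epsilon> \<ge> 0 \<Longrightarrow> x \<in> S \<Longrightarrow> eps_convex_on S f \<epsilon> \<Longrightarrow> eps_subgradient S f \<epsilon> x \<phi>"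
    using subgradient_exists[OF conv r] lip r by (metis centre_in_ball)
  have lin: "linear \<phi>" using \<phi>(1) by (simp add: dual_ball_def)
  have "(f has_derivative \<phi>) (at x)"
    unfolding has_derivative_at_alt
  proof (intro conjI allI impI)
    show "bounded_linear \<phi>" using \<phi>(1) by (rule bounded_linear_dual_ball)
    fix e :: real assume e: "e > 0"
    obtain \<delta> where \<delta>: "\<delta> > 0" "eps_convex_on (ball x \<delta>) f (e / 2)"
      using approximately_convex_at_eps_convex[OF conv, of "e / 2"] e by auto
    have sub: "eps_subgradient (ball x \<delta>) f (e / 2) x \<phi>" using \<phi>(2) \<delta> e by auto
    obtain \<delta>' where \<delta>': "\<delta>' > 0"
      "\<And>h. norm h < \<delta>' \<Longrightarrow> f (x + h) + f (x - h) - 2 * f x \<le> e / 2 * norm h"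
      using sym[of "e / 2"] e by auto
    show "\<exists>d>0. \<forall>y. norm (y - x) < d \<longrightarrow> norm (f y - f x - \<phi> (y - x)) \<le> e * norm (y - x)"
    proof (intro exI conjI allI impI)
      show "min \<delta> \<delta>' > 0" using \<delta> \<delta>' by simp
      fix y assume y: "norm (y - x) < min \<delta> \<delta>'"
      define h where "h = y - x"
      have "x + h \<in> ball x \<delta>" "x - h \<in> ball x \<delta>" using y by (auto simp: h_def dist_norm norm_minus_commute)
      then have "\<phi> (x + h - x) \<le> f (x + h) - f x + e / 2 * norm (x + h - x)"
        and "\<phi> (x - h - x) \<le> f (x - h) - f x + e / 2 * norm (x - h - x)"
        using sub unfolding eps_subgradient_def by blast+
      then have "\<phi> h \<le> f (x + h) - f x + e / 2 * norm h"
        and "- \<phi> h \<le> f (x - h) - f x + e / 2 * norm h" using lin by (simp_all add: linear_neg)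
      moreover have "f (x + h) + f (x - h) - 2 * f x \<le> e / 2 * norm h" using y by (intro \<delta>'(2)) (simp add: h_def)
      moreover have "0 \<le> e / 2 * norm h" using e by simp
      moreover have "e * norm h = e / 2 * norm h + e / 2 * norm h" by simp
      ultimately have "\<bar>f (x + h) - f x - \<phi> h\<bar> \<le> e * norm h" by linarith
      then show "norm (f y - f x - \<phi> (y - x)) \<le> e * norm (y - x)" by (simp add: h_def)
    qed
  qed
  then show ?thesis by (auto simp: differentiable_def)
qed

section \<open>Pieces on which subgradients are nearly constant\<close>

text \<open>
  On norm-bounded sets of functionals, evaluation is jointly continuous for the norm topology and the
  weak-star topology, by the common Lipschitz constant.
\<close>

lemma continuous_on_evaluation_dual_ball:
  "continuous_on (UNIV \<times> dual_ball K) (\<lambda>q :: 'a::real_normed_vector \<times> _. snd q (fst q))"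
  unfolding continuous_on_def
proof
  fix p :: "'a \<times> ('a \<Rightarrow> real)" assume p: "p \<in> UNIV \<times> dual_ball K"
  obtain x \<phi> where p_eq: "p = (x, \<phi>)" and \<phi>: "\<phi> \<in> dual_ball K" using p by auto
  let ?F = "at p within UNIV \<times> dual_ball K"
  have "((\<lambda>q. snd q x - snd p x) \<longlongrightarrow> snd p x - snd p x) ?F"
  proof (intro tendsto_diff tendsto_const)
    have "continuous_on UNIV (\<lambda>q :: 'a \<times> ('a \<Rightarrow> real). snd q x)"
      by (rule continuous_on_compose2[OF continuous_on_product_coordinates continuous_on_snd]) auto
    then have "((\<lambda>q. snd q x) \<longlongrightarrow> snd p x) (at p)" by (simp add: continuous_on_def p_eq)
    then show "((\<lambda>q. snd q x) \<longlongrightarrow> snd p x) ?F" by (rule tendsto_within_subset) simp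
  qed
  moreover have "((\<lambda>q. snd q (fst q) - snd q x) \<longlongrightarrow> 0) ?F"
  proof (rule Lim_null_comparison)
    show "\<forall>\<^sub>F q in ?F. norm (snd q (fst q) - snd q x) \<le> K * norm (fst q - x)"
      unfolding eventually_at_filter
    proof (rule always_eventually, intro allI impI)
      fix q :: "'a \<times> ('a \<Rightarrow> real)" assume "q \<in> UNIV \<times> dual_ball K"
      then have q: "snd q \<in> dual_ball K" by auto
      then have "snd q (fst q) - snd q x = snd q (fst q - x)" by (simp add: dual_ball_def linear_diff)
      then show "norm (snd q (fst q) - snd q x) \<le> K * norm (fst q - x)" using q by (simp add: dual_ball_def)
    qed
    have "((\<lambda>q. K * norm (fst q - x)) \<longlongrightarrow> K * norm (fst p - x)) ?F"
      by (intro tendsto_intros tendsto_fst tendsto_ident_at)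
    then show "((\<lambda>q. K * norm (fst q - x)) \<longlongrightarrow> 0) ?F" by (simp add: p_eq)
  qed
  ultimately have "((\<lambda>q. (snd q x - snd p x) + (snd q (fst q) - snd q x) + snd p x) \<longlongrightarrow>
      (snd p x - snd p x) + 0 + snd p x) ?F"
    by (intro tendsto_add tendsto_const)
  then show "((\<lambda>q. snd q (fst q)) \<longlongrightarrow> snd p (fst p)) ?F" by (simp add: p_eq)
qed

lemma closed_eps_subgradient_graph:
  fixes f :: "'a::real_normed_vector \<Rightarrow> real"
  assumes C: "closed C" and f: "continuous_on C f"
  shows "closed {(x, \<phi>). x \<in> C \<and> \<phi> \<in> dual_ball K \<and> eps_subgradient S f \<epsilon> x \<phi>}"
proof -
  let ?D = "C \<times> (dual_ball K :: ('a \<Rightarrow> real) set)"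
  have clD: "closed ?D" by (intro closed_Times C closed_dual_ball)
  have cl: "closed (?D \<inter> (\<lambda>q. f w - f (fst q) + \<epsilon> * norm (w - fst q) - snd q (w - fst q)) -` {0..})" for w
  proof (rule continuous_closed_preimage[OF _ clD])
    have "continuous_on ?D (\<lambda>q. f (fst q))"
      by (rule continuous_on_compose2[OF f continuous_on_fst]) (auto intro: continuous_intros)
    moreover have "continuous_on ?D (\<lambda>q. snd (w - fst q, snd q) (fst (w - fst q, snd q)))"
      by (rule continuous_on_compose2[OF continuous_on_evaluation_dual_ball[of K]])
        (auto intro!: continuous_on_Pair continuous_on_diff continuous_on_const continuous_on_fst
          continuous_on_snd continuous_on_id)
    ultimately show "continuous_on ?D (\<lambda>q. f w - f (fst q) + \<epsilon> * norm (w - fst q) - snd q (w - fst q))"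
      by (intro continuous_intros) auto
  qed auto
  have "closed (?D \<inter> (\<Inter>w\<in>S. ?D \<inter> (\<lambda>q. f w - f (fst q) + \<epsilon> * norm (w - fst q) - snd q (w - fst q)) -` {0..}))"
    by (rule closed_Int[OF clD closed_INT[OF ballI]]) (rule cl)
  also have "?D \<inter> (\<Inter>w\<in>S. ?D \<inter> (\<lambda>q. f w - f (fst q) + \<epsilon> * norm (w - fst q) - snd q (w - fst q)) -` {0..}) =
    {(x, \<phi>). x \<in> C \<and> \<phi> \<in> dual_ball K \<and> eps_subgradient S f \<epsilon> x \<phi>}"
    by (auto simp: eps_subgradient_def)
  finally show ?thesis .
qed

text \<open>
  The sets from which porous sets are built: the points of \<open>U\<close> have subgradients that are \<open>\<epsilon>\<close>-close to a
  single functional \<open>\<phi>\<close>. The neighbourhood \<open>V\<close> supplies the vertices of the cones, which need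
  not belong to \<open>U\<close> but must have subgradients too.
\<close>

definition nearly_constant_subgradient :: "('a::real_normed_vector \<Rightarrow> real) \<Rightarrow> real \<Rightarrow> 'a set \<Rightarrow> bool" where
  "nearly_constant_subgradient f \<epsilon> U \<longleftrightarrow>
    (\<exists>V \<phi>. open V \<and> U \<subseteq> V \<and> bounded_linear \<phi> \<and>
      (\<forall>z\<in>V. \<exists>\<psi>. bounded_linear \<psi> \<and> eps_subgradient V f \<epsilon> z \<psi>) \<and>
      (\<forall>y\<in>U. \<exists>\<psi>. bounded_linear \<psi> \<and> eps_subgradient V f \<epsilon> y \<psi> \<and> (\<forall>u. \<bar>\<psi> u - \<phi> u\<bar> \<le> \<epsilon> * norm u)))"

text \<open>
  On a small closed ball in the remainder \<open>G - W\<close>, the subgradient graph is a closed relation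
  with values in one dual ball and with full domain. Fragmentability of the dual ball then provides a
  relatively open piece on which a selection of subgradients has small range.
\<close>

lemma nearly_constant_subgradient_piece:
  fixes f :: "'a::banach \<Rightarrow> real"
  assumes asplund: "asplund_space TYPE('a)" and G: "open G" and cont: "continuous_on G f"
    and conv: "approximately_convex_on G f" and \<epsilon>: "\<epsilon> > 0"
    and W: "open W" "\<not> G \<subseteq> W"
  shows "\<exists>V. open V \<and> V \<inter> (G - W) \<noteq> {} \<and> nearly_constant_subgradient f \<epsilon> (V \<inter> (G - W))"
proof -
  obtain x0 where x0: "x0 \<in> G" "x0 \<notin> W" using W by blast
  have convx: "approximately_convex_at G f x" if "x \<in> G" for x
    using conv that by (simp add: approximately_convex_on_def)
  obtain r K where r: "r > 0" "ball x0 r \<subseteq> G" "eps_convex_on (ball x0 r) f \<epsilon>"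
    and lip: "\<And>x y. x \<in> ball x0 r \<Longrightarrow> y \<in> ball x0 r \<Longrightarrow> \<bar>f y - f x\<bar> \<le> K * norm (y - x)"
    using approximately_convex_locally_lipschitz[OF convx[OF x0(1)] G x0(1) cont \<epsilon>] by metis
  have sub: "\<exists>\<phi>\<in>dual_ball K. eps_subgradient (ball x0 r) f \<epsilon> x \<phi>" if x: "x \<in> ball x0 r" for x
  proof -
    obtain \<rho> where \<rho>: "\<rho> > 0" "ball x \<rho> \<subseteq> ball x0 r" using x open_ball open_contains_ball by blast
    have "\<bar>f y - f x\<bar> \<le> K * norm (y - x)" if "y \<in> ball x \<rho>" for y using lip x \<rho>(2) that by blast
    then obtain \<phi> where "\<phi> \<in> dual_ball K"
      "\<And>S \<epsilon>. \<epsilon> \<ge> 0 \<Longrightarrow> x \<in> S \<Longrightarrow> eps_convex_on S f \<epsilon> \<Longrightarrow> eps_subgradient S f \<epsilon> x \<phi>"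
      using subgradient_exists[OF convx \<rho>(1)] x r(2) by blast
    then show ?thesis using x r(3) \<epsilon> by (meson less_imp_le)
  qed
  define C where "C = cball x0 (r / 2) - W"
  have Cr: "C \<subseteq> ball x0 r" using r(1) by (auto simp: C_def)
  define \<Gamma> where "\<Gamma> = {(x, \<phi>). x \<in> C \<and> \<phi> \<in> dual_ball K \<and> eps_subgradient (ball x0 r) f \<epsilon> x \<phi>}"
  have cl: "closed \<Gamma>"
    unfolding \<Gamma>_def
  proof (rule closed_eps_subgradient_graph)
    show "closed C" unfolding C_def using W(1) by (intro closed_Diff) auto
    show "continuous_on C f" using cont Cr r(2) by (blast intro: continuous_on_subset)
  qed
  have fst\<Gamma>: "fst ` \<Gamma> = C"
  proof
    show "fst ` \<Gamma> \<subseteq> C" by (auto simp: \<Gamma>_def)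
    show "C \<subseteq> fst ` \<Gamma>"
    proof
      fix x assume x: "x \<in> C"
      then obtain \<phi> where "\<phi> \<in> dual_ball K" "eps_subgradient (ball x0 r) f \<epsilon> x \<phi>" using sub Cr by blast
      then have "(x, \<phi>) \<in> \<Gamma>" using x by (simp add: \<Gamma>_def)
      then show "x \<in> fst ` \<Gamma>" by (rule rev_image_eqI) simp
    qed
  qed
  have "x0 \<in> ball x0 (r / 2) \<inter> fst ` \<Gamma>" using x0 r(1) by (simp add: fst\<Gamma> C_def)
  then have ne: "ball x0 (r / 2) \<inter> fst ` \<Gamma> \<noteq> {}" by blast
  have \<Gamma>K: "\<Gamma> \<subseteq> UNIV \<times> dual_ball K" by (auto simp: \<Gamma>_def)
  let ?small = "\<lambda>T :: ('a \<Rightarrow> real) set. \<forall>\<phi>\<in>T. \<forall>\<psi>\<in>T. \<forall>u. \<bar>\<phi> u - \<psi> u\<bar> \<le> \<epsilon> * norm u"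
  have "\<exists>U T. open U \<and> U \<subseteq> ball x0 (r / 2) \<and> U \<inter> fst ` \<Gamma> \<noteq> {} \<and> ?small T \<and>
      (\<forall>x\<in>U \<inter> fst ` \<Gamma>. \<exists>k\<in>T. (x, k) \<in> \<Gamma>)"
    by (rule fragmented_selection[OF compact_dual_ball cl \<Gamma>K _ open_ball ne])
      (rule asplund_dual_ball_fragmented[OF asplund _ _ \<epsilon>])
  then obtain U T where U: "open U" "U \<subseteq> ball x0 (r / 2)" "U \<inter> C \<noteq> {}"
    and T: "\<forall>\<phi>\<in>T. \<forall>\<psi>\<in>T. \<forall>u. \<bar>\<phi> u - \<psi> u\<bar> \<le> \<epsilon> * norm u"
    and UT: "\<forall>x\<in>U \<inter> C. \<exists>k\<in>T. (x, k) \<in> \<Gamma>"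
    unfolding fst\<Gamma> by (elim exE conjE) (rule that)
  have "U \<subseteq> cball x0 (r / 2)" "cball x0 (r / 2) \<subseteq> G"
    using U(2) r by (auto intro: order_trans[OF _ r(2)])
  then have UC: "U \<inter> (G - W) = U \<inter> C" unfolding C_def by blast
  obtain \<phi> where \<phi>: "\<phi> \<in> T" "\<phi> \<in> dual_ball K"
  proof -
    obtain x where "x \<in> U \<inter> C" using U(3) by blast
    then obtain k where "k \<in> T" "(x, k) \<in> \<Gamma>" using UT by blast
    then show ?thesis using that[of k] by (simp add: \<Gamma>_def)
  qed
  have "nearly_constant_subgradient f \<epsilon> (U \<inter> C)"
    unfolding nearly_constant_subgradient_def
  proof (rule exI[of _ "ball x0 r"], rule exI[of _ \<phi>], intro conjI ballI)
    show "open (ball x0 r)" by simp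
    show "U \<inter> C \<subseteq> ball x0 r" using Cr by blast
    show "bounded_linear \<phi>" using \<phi>(2) by (rule bounded_linear_dual_ball)
    show "\<exists>\<psi>. bounded_linear \<psi> \<and> eps_subgradient (ball x0 r) f \<epsilon> z \<psi>" if "z \<in> ball x0 r" for z
      using sub[OF that] bounded_linear_dual_ball by blast
    fix y assume "y \<in> U \<inter> C"
    then obtain \<psi> where \<psi>: "\<psi> \<in> T" "(y, \<psi>) \<in> \<Gamma>" using UT by blast
    then have "\<psi> \<in> dual_ball K" "eps_subgradient (ball x0 r) f \<epsilon> y \<psi>" by (auto simp: \<Gamma>_def)
    moreover have "\<forall>u. \<bar>\<psi> u - \<phi> u\<bar> \<le> \<epsilon> * norm u" using T \<psi>(1) \<phi>(1) by blast
    ultimately show "\<exists>\<psi>. bounded_linear \<psi> \<and> eps_subgradient (ball x0 r) f \<epsilon> y \<psi> \<and> (\<forall>u. \<bar>\<psi> u - \<phi> u\<bar> \<le> \<epsilon> * norm u)"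
      using bounded_linear_dual_ball by blast
  qed
  then show ?thesis using U UC by (intro exI[of _ U]) simp
qed

section \<open>Cone porosity\<close>

text \<open>
  Let \<open>\<epsilon> = \<alpha> c / 10\<close>. Since \<open>f\<close> has a kink at \<open>x\<close>, there is an arbitrarily small \<open>k\<close> along which \<open>f\<close>
  grows by more than \<open>c / 2\<close> times the norm of \<open>k\<close> above the subgradient \<open>\<psi>\<close> at \<open>x\<close>. A subgradient
  \<open>\<zeta>\<close> at \<open>z = x + k\<close> must therefore be far from \<open>\<psi>\<close>, hence far from \<open>\<phi>\<close>: the norm of \<open>\<zeta> - \<phi>\<close> is at least
  \<open>c / 2 - 2 \<epsilon>\<close>. On the other hand, approximate monotonicity of subgradients gives
  \<open>(\<zeta> - \<phi>) (y - z) \<le> 3 \<epsilon> norm (y - z)\<close> for each nearby point \<open>y\<close> of the set. By the choice of \<open>\<epsilon>\<close>,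
  these points avoid the cone with vertex \<open>z\<close> given by \<open>\<zeta> - \<phi>\<close>.
\<close>

lemma cone_porous_if_nearly_constant_subgradient:
  fixes f :: "'a::real_normed_vector \<Rightarrow> real"
  assumes \<alpha>: "0 < \<alpha>" "\<alpha> < 1" and c: "c > 0"
    and loc: "\<And>x. x \<in> A \<Longrightarrow> \<exists>r>0. \<exists>U. nearly_constant_subgradient f (\<alpha> * c / 10) U \<and> A \<inter> ball x r \<subseteq> U"
    and kink: "\<And>x \<delta>. x \<in> A \<Longrightarrow> \<delta> > 0 \<Longrightarrow> \<exists>h. norm h < \<delta> \<and> c * norm h < f (x + h) + f (x - h) - 2 * f x"
  shows "cone_porous \<alpha> A"
  unfolding cone_porous_def cone_porous_at_def
proof
  fix x assume x: "x \<in> A"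
  define \<epsilon> where "\<epsilon> = \<alpha> * c / 10"
  have \<epsilon>: "\<epsilon> > 0" "\<epsilon> < c / 10" using \<alpha> c by (simp_all add: \<epsilon>_def)
  have \<epsilon>\<alpha>: "3 * \<epsilon> \<le> \<alpha> * (c / 2 - 2 * \<epsilon>)"
  proof -
    have "\<alpha> * (3 * c / 10) \<le> \<alpha> * (c / 2 - 2 * \<epsilon>)" using \<alpha> \<epsilon> by (intro mult_left_mono) auto
    then show ?thesis by (simp add: \<epsilon>_def)
  qed
  obtain r U where r: "r > 0" "nearly_constant_subgradient f \<epsilon> U" "A \<inter> ball x r \<subseteq> U"
    using loc[OF x] unfolding \<epsilon>_def by blast
  obtain V \<phi> where V: "open V" "U \<subseteq> V" and \<phi>: "bounded_linear \<phi>"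
    and sub: "\<And>z. z \<in> V \<Longrightarrow> \<exists>\<psi>. bounded_linear \<psi> \<and> eps_subgradient V f \<epsilon> z \<psi>"
    and near: "\<And>y. y \<in> U \<Longrightarrow> \<exists>\<psi>. bounded_linear \<psi> \<and> eps_subgradient V f \<epsilon> y \<psi> \<and> (\<forall>u. \<bar>\<psi> u - \<phi> u\<bar> \<le> \<epsilon> * norm u)"
    using r(2) unfolding nearly_constant_subgradient_def by blast
  have xU: "x \<in> U" using r x by auto
  obtain R0 where R0: "R0 > 0" "ball x R0 \<subseteq> V" using V xU open_contains_ball by blast
  define R where "R = min r R0"
  have R: "R > 0" "ball x R \<subseteq> V" "A \<inter> ball x R \<subseteq> U" using r R0 by (auto simp: R_def)
  obtain \<psi> where \<psi>: "bounded_linear \<psi>" "eps_subgradient V f \<epsilon> x \<psi>" "\<And>u. \<bar>\<psi> u - \<phi> u\<bar> \<le> \<epsilon> * norm u"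
    using near[OF xU] by blast
  have "\<exists>z\<in>ball x \<eta>. \<exists>x' :: 'a \<Rightarrow>\<^sub>L real. x' \<noteq> 0 \<and> ball x R \<inter> (+) z ` dual_cone x' \<alpha> \<inter> A = {}"
    if \<eta>: "\<eta> > 0" for \<eta>
  proof -
    obtain h where h: "norm h < min \<eta> R" "c * norm h < f (x + h) + f (x - h) - 2 * f x"
      using kink[OF x, of "min \<eta> R"] \<eta> R(1) by auto
    have \<psi>m: "\<psi> (- h) = - \<psi> h" using \<psi>(1) by (simp add: bounded_linear.linear linear_neg)
    \<comment> \<open>one of the two directions \<open>h\<close> and \<open>- h\<close> carries at least half of the symmetric kink\<close>
    obtain k where k: "norm k < \<eta>" "norm k < R" "c / 2 * norm k < f (x + k) - f x - \<psi> k"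
    proof (cases "c / 2 * norm h < f (x + h) - f x - \<psi> h")
      case True
      then show ?thesis using that[of h] h by simp
    next
      case False
      then have "c / 2 * norm h < f (x - h) - f x + \<psi> h" using h(2) by (simp add: field_simps)
      then show ?thesis using that[of "- h"] h \<psi>m by simp
    qed
    have "k \<noteq> 0" using k(3) \<psi>(1) by (auto simp: bounded_linear.linear linear_0)
    define z where "z = x + k"
    have z: "z \<in> ball x \<eta>" "z \<in> V" using k R(2) by (auto simp: z_def dist_norm)
    obtain \<zeta> where \<zeta>: "bounded_linear \<zeta>" "eps_subgradient V f \<epsilon> z \<zeta>" using sub[OF z(2)] by blast
    have lin: "linear \<zeta>" using \<zeta>(1) by (rule bounded_linear.linear)
    define x' where "x' = Blinfun (\<lambda>u. \<zeta> u - \<phi> u)"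
    have x': "blinfun_apply x' u = \<zeta> u - \<phi> u" for u
      unfolding x'_def using \<zeta>(1) \<phi> by (subst bounded_linear_Blinfun_apply) (auto intro: bounded_linear_sub)
    have "x \<in> V" using xU V by blast
    then have "\<zeta> (x - z) \<le> f x - f z + \<epsilon> * norm (x - z)" using \<zeta>(2) by (simp add: eps_subgradient_def)
    then have "f (x + k) - f x \<le> \<zeta> k + \<epsilon> * norm k" using lin by (simp add: z_def linear_neg)
    then have "(c / 2 - 2 * \<epsilon>) * norm k < blinfun_apply x' k"
      using k(3) \<psi>(3)[of k] unfolding x' abs_le_iff by (simp add: algebra_simps)
    also have "\<dots> \<le> norm x' * norm k" using norm_blinfun[of x' k] by simp
    finally have big: "c / 2 - 2 * \<epsilon> \<le> norm x'" using \<open>k \<noteq> 0\<close> by simp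
    then have "x' \<noteq> 0" using \<epsilon> by auto
    moreover have "y \<notin> A" if y: "y \<in> ball x R" "y \<in> (+) z ` dual_cone x' \<alpha>" for y
    proof
      assume "y \<in> A"
      then have yU: "y \<in> U" using R(3) y(1) by blast
      define v where "v = y - z"
      have v: "\<alpha> * norm v * norm x' < \<zeta> v - \<phi> v"
        using y(2) by (auto simp: dual_cone_def v_def x')
      obtain \<theta> where \<theta>: "bounded_linear \<theta>" "eps_subgradient V f \<epsilon> y \<theta>" "\<And>u. \<bar>\<theta> u - \<phi> u\<bar> \<le> \<epsilon> * norm u"
        using near[OF yU] by blast
      have nv: "norm (z - y) = norm v" "norm (y - z) = norm v" by (simp_all add: v_def norm_minus_commute)
      have "\<theta> (z - y) \<le> f z - f y + \<epsilon> * norm v"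
        using \<theta>(2) z(2) unfolding eps_subgradient_def nv(1)[symmetric] by blast
      moreover have "\<theta> (z - y) = - \<theta> v"
        using linear_neg[OF bounded_linear.linear[OF \<theta>(1)], of v] by (simp add: v_def)
      moreover have "\<zeta> v \<le> f y - f z + \<epsilon> * norm v"
        using \<zeta>(2) yU V(2) unfolding eps_subgradient_def v_def by blast
      ultimately have "\<zeta> v \<le> \<theta> v + 2 * (\<epsilon> * norm v)" by linarith
      moreover have "\<theta> v \<le> \<phi> v + \<epsilon> * norm v" using \<theta>(3)[of v] by linarith
      ultimately have "\<zeta> v - \<phi> v \<le> 3 * \<epsilon> * norm v" by linarith
      also have "\<dots> \<le> (\<alpha> * norm x') * norm v"
      proof (rule mult_right_mono)
        have "\<alpha> * (c / 2 - 2 * \<epsilon>) \<le> \<alpha> * norm x'" using big \<alpha> by (intro mult_left_mono) auto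
        then show "3 * \<epsilon> \<le> \<alpha> * norm x'" using \<epsilon>\<alpha> by linarith
      qed simp
      finally show False using v by (simp add: mult_ac)
    qed
    ultimately show ?thesis using z(1) by blast
  qed
  then show "\<exists>R>0. \<forall>\<epsilon>>0. \<exists>z\<in>ball x \<epsilon>. \<exists>x' :: 'a \<Rightarrow>\<^sub>L real. x' \<noteq> 0 \<and> ball x R \<inter> (+) z ` dual_cone x' \<alpha> \<inter> A = {}"
    using R(1) by blast
qed

lemma sigma_cone_porous_UN:
  fixes B :: "nat \<Rightarrow> nat \<Rightarrow> 'a::real_normed_vector set"
  assumes "\<And>n m. cone_porous \<alpha> (B n m)"
  shows "sigma_cone_porous \<alpha> (\<Union>n. \<Union>m. B n m)"
  unfolding sigma_cone_porous_def
proof (intro exI[of _ "\<lambda>k. B (fst (prod_decode k)) (snd (prod_decode k))"] conjI allI assms equalityI subsetI)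
  fix x assume "x \<in> (\<Union>n. \<Union>m. B n m)"
  then obtain n m where "x \<in> B n m" by blast
  then show "x \<in> (\<Union>k. B (fst (prod_decode k)) (snd (prod_decode k)))"
    by (intro UN_I[of "prod_encode (n, m)"]) simp_all
qed blast

theorem theorem6p3:
  fixes G :: "'a::banach set" and f :: "'a \<Rightarrow> real"
  assumes "asplund_space TYPE('a)"
    and "open G"
    and "continuous_on G f"
    and "approximately_convex_on G f"
  shows "cone_small {x \<in> G. \<not> f differentiable (at x)}"
  unfolding cone_small_def
proof (intro allI impI)
  fix \<alpha> :: real assume \<alpha>: "0 < \<alpha> \<and> \<alpha> < 1"
  define N where "N = {x \<in> G. \<not> f differentiable (at x)}"
  define c where "c n = 1 / real (Suc n)" for n
  have c: "c n > 0" for n by (simp add: c_def)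
  \<comment> \<open>the points of \<open>N\<close> where the kink of \<open>f\<close> has size at least \<open>c n\<close>\<close>
  define A where "A n = {x \<in> N. \<forall>\<delta>>0. \<exists>h. norm h < \<delta> \<and> c n * norm h < f (x + h) + f (x - h) - 2 * f x}" for n
  have "\<exists>n. x \<in> A n" if x: "x \<in> N" for x
  proof (rule ccontr)
    assume "\<not> (\<exists>n. x \<in> A n)"
    then have sm: "\<exists>\<delta>>0. \<forall>h. norm h < \<delta> \<longrightarrow> f (x + h) + f (x - h) - 2 * f x \<le> c n * norm h"
      for n
    proof -
      have "\<not> (\<forall>\<delta>>0. \<exists>h. norm h < \<delta> \<and> c n * norm h < f (x + h) + f (x - h) - 2 * f x)"
        using x \<open>\<not> (\<exists>n. x \<in> A n)\<close> unfolding A_def by blast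
      then show ?thesis by (meson not_less)
    qed
    have xG: "x \<in> G" using x by (simp add: N_def)
    then have "approximately_convex_at G f x" using assms(4) by (simp add: approximately_convex_on_def)
    then have "f differentiable (at x)"
    proof (rule differentiable_if_symmetric[OF _ assms(2) xG assms(3)])
      fix e :: real assume "e > 0"
      then obtain n where n: "c n < e" using reals_Archimedean[of e] by (auto simp: c_def inverse_eq_divide)
      obtain \<delta> where \<delta>: "\<delta> > 0" "\<And>h. norm h < \<delta> \<Longrightarrow> f (x + h) + f (x - h) - 2 * f x \<le> c n * norm h"
        using sm[of n] by blast
      have "f (x + h) + f (x - h) - 2 * f x \<le> e * norm h" if "norm h < \<delta>" for h
        using \<delta>(2)[OF that] mult_right_mono[of "c n" e "norm h"] n by simp
      then show "\<exists>\<delta>>0. \<forall>h. norm h < \<delta> \<longrightarrow> f (x + h) + f (x - h) - 2 * f x \<le> e * norm h"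
        using \<delta>(1) by blast
    qed
    then show False using x by (simp add: N_def)
  qed
  then have N_eq: "N = (\<Union>n. A n)" by (auto simp: A_def)
  have "\<exists>B :: nat \<Rightarrow> 'a set. G = (\<Union>m. B m) \<and>
      (\<forall>m. \<forall>x\<in>B m. \<exists>r>0. \<exists>U. nearly_constant_subgradient f (\<alpha> * c n / 10) U \<and> B m \<inter> ball x r \<subseteq> U)" for n
  proof -
    have "\<alpha> * c n / 10 > 0" using \<alpha> c by simp
    note piece = nearly_constant_subgradient_piece[OF assms this]
    show ?thesis
    proof (rule sigma_locally_contained[OF piece])
      fix B :: "nat \<Rightarrow> 'a set"
      assume "G = (\<Union>m. B m)"
        "\<And>m x. x \<in> B m \<Longrightarrow> \<exists>r>0. \<exists>U. nearly_constant_subgradient f (\<alpha> * c n / 10) U \<and> B m \<inter> ball x r \<subseteq> U"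
      then show ?thesis by (intro exI[of _ B] conjI allI ballI)
    qed
  qed
  then have "\<forall>n. \<exists>B :: nat \<Rightarrow> 'a set. G = (\<Union>m. B m) \<and>
      (\<forall>m. \<forall>x\<in>B m. \<exists>r>0. \<exists>U. nearly_constant_subgradient f (\<alpha> * c n / 10) U \<and> B m \<inter> ball x r \<subseteq> U)" ..
  from choice[OF this] obtain B :: "nat \<Rightarrow> nat \<Rightarrow> 'a set" where B: "\<forall>n. G = (\<Union>m. B n m) \<and>
      (\<forall>m. \<forall>x\<in>B n m. \<exists>r>0. \<exists>U. nearly_constant_subgradient f (\<alpha> * c n / 10) U \<and> B n m \<inter> ball x r \<subseteq> U)" ..
  have B1: "G = (\<Union>m. B n m)" for n using B[rule_format, of n] by (rule conjunct1)
  have B2: "\<exists>r>0. \<exists>U. nearly_constant_subgradient f (\<alpha> * c n / 10) U \<and> B n m \<inter> ball x r \<subseteq> U"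
    if "x \<in> B n m" for n m x
    using B[rule_format, of n, THEN conjunct2, rule_format, OF that] .
  have porous: "cone_porous \<alpha> (A n \<inter> B n m)" for n m
  proof (rule cone_porous_if_nearly_constant_subgradient[of \<alpha> "c n" _ f])
    fix x assume "x \<in> A n \<inter> B n m"
    then show "\<exists>r>0. \<exists>U. nearly_constant_subgradient f (\<alpha> * c n / 10) U \<and> (A n \<inter> B n m) \<inter> ball x r \<subseteq> U"
      using B2[of x n m] by blast
  qed (use \<alpha> c in \<open>auto simp: A_def\<close>)
  have "N = (\<Union>n. \<Union>m. A n \<inter> B n m)"
  proof -
    have "A n \<subseteq> G" for n by (auto simp: A_def N_def)
    then have "A n = (\<Union>m. A n \<inter> B n m)" for n using B1[of n] by blast
    then show ?thesis using N_eq by simp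
  qed
  then show "sigma_cone_porous \<alpha> {x \<in> G. \<not> f differentiable (at x)}"
    using sigma_cone_porous_UN[of \<alpha> "\<lambda>n m. A n \<inter> B n m", OF porous] by (simp add: N_def)
qed

end
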